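(* For the compound Markov binomial process with $X_0=0$, the distribution of the upper hitting time of the level $a\in\mathbb{N}$ can be expressed, for $n\geq a$, as $$\mathbb{P}\left(\tau_a^+=n,\,J_{\tau_a^+}\right)=\mathbf{Q}(n,a).$$
   Context: $\mathbb{N}=\{0,1,2,\dots\}$. $\{J_n\}_{n\in\mathbb{N}}$ is an ergodic time-homogeneous Markov chain on $E=\{1,\dots,N\}$ with transition matrix $\mathbf{P}$. The claims $\{C_k\}_{k\ge1}$ are non-negative integer-valued and conditionally i.i.d. given the chain in the sense that $(C,J)$ has the Markov additive property: given $J_{k-1}=i$, the pair $(C_k,J_k)$ is independent of the past and $\lambda_{ij}(m):=\mathbb{P}(C_k=m,J_k=j\mid J_{k-1}=i)$ does not depend on $k$. $\mathbf{\Lambda}(m)=(\lambda_{ij}(m))_{i,j\in E}$, so $\sum_{m\ge0}\mathbf{\Lambda}(m)=\mathbf{P}$. Standing assumption: $\lambda_{ij}(0)>0$ for all $i,j\in E$ and $\mathbf{\Lambda}(0)$ is invertible. $X_n=n-\sum_{k=1}^nC_k$ (so $X_0=0$), and $\tau_a^+=\min\{n\geq0:X_n\geq a\}$. The notation $\mathbb{P}(\tau_a^+=n,J_{\tau_a^+})$ is the $N\times N$ matrix with $(i,j)$ entry $\mathbb{P}(\tau_a^+=n,J_{\tau_a^+}=j\mid J_0=i)$. Definition of $\mathbf{Q}(n,a)$. Let $\mathbf{G}=(G_{ij})_{i,j\in E}$ be a matrix of $N^2$ independent variables and $D_{ij}=\partial/\partial G_{ij}$. Put $\widehat{\mathbf{\Lambda}}^{\leftarrow}(\mathbf{G})=\sum_{m\ge0}\mathbf{\Lambda}(m)\mathbf{G}^m$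 and $\widehat\lambda^{\leftarrow}_{ij}(\mathbf{G})=(\widehat{\mathbf{\Lambda}}^{\leftarrow}(\mathbf{G}))_{ij}$. Let $\mathbf{\Gamma}^{\leftarrow}(\mathbf{G})$ be the $N^2\times N^2$ matrix with entries $\gamma_{ij,kl}(\mathbf{G})=G_{ij}\,D_{kl}\{\ln[\widehat\lambda^{\leftarrow}_{ij}(\mathbf{G})]\}$, $i,j,k,l\in E$ (rows indexed by pairs $ij$, columns by pairs $kl$), let $\mathbf{I}$ be the $N^2\times N^2$ identity matrix and $|\cdot|$ the determinant. Then $$\mathbf{Q}(n,a)=\sum_{\substack{x_{11},\dots,x_{NN}\ge0\\ x_{11}+\cdots+x_{NN}=n}}\frac{1}{x_{11}!\cdots x_{NN}!}\,\mathbf{B}(\vec x,a),$$ $$\mathbf{B}(\vec x,a)=\left[\prod_{i=1}^N\prod_{j=1}^ND_{ij}^{x_{ij}}\left(\mathbf{G}^a\prod_{i=1}^N\prod_{j=1}^N\widehat\lambda^{\leftarrow}_{ij}(\mathbf{G})^{x_{ij}}\,\big|\mathbf{I}-\mathbf{\Gamma}^{\leftarrow}(\mathbf{G})\big|\right)\right]_{\mathbf{G}=\mathbf{0}},$$ where the sum is over vectors $\vec x=(x_{ij})_{i,j\in E}$ of $N^2$ non-negative integers, the differential operators act on everything to their right, and they act element-wise on the matrix $\mathbf{G}^a$. *)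

theory Defs
  imports "HOL-Probability.Probability"
begin

section \<open>Matrix powers and ergodic transition matrices\<close>

type_synonym 'n sqmat = "real^'n^'n"

text \<open>The power operator of the type \<open>real^'n^'n\<close> is the componentwise one, hence
  this definition.\<close>

primrec mpow :: "'n::finite sqmat \<Rightarrow> nat \<Rightarrow> 'n sqmat" where
  "mpow G 0 = mat 1"
| "mpow G (Suc m) = G ** mpow G m"

definition irreducible_mat :: "'n::finite sqmat \<Rightarrow> bool" where
  "irreducible_mat P \<longleftrightarrow> (\<forall>i j. \<exists>k. mpow P k $ i $ j > 0)"

definition aperiodic_mat :: "'n::finite sqmat \<Rightarrow> bool" where
  "aperiodic_mat P \<longleftrightarrow> (\<forall>i. Gcd {k::nat. k > 0 \<and> mpow P k $ i $ i > 0} = 1)"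

text \<open>On a finite state space positive recurrence follows from irreducibility.\<close>

definition ergodic_mat :: "'n::finite sqmat \<Rightarrow> bool" where
  "ergodic_mat P \<longleftrightarrow> irreducible_mat P \<and> aperiodic_mat P"


section \<open>The compound Markov binomial process\<close>

text \<open>The state space is a finite type. The initial
  distribution is arbitrary, so identities for probabilities given \<open>J 0 = i\<close> or \<open>J n = i\<close>
  are only meaningful, and only required, when the conditioning event is not null.\<close>

locale ergodic_markov_chain = prob_space M
  for M :: "'w measure"
  and J :: "nat \<Rightarrow> 'w \<Rightarrow> 'n::finite"
  and P :: "'n sqmat" +
  assumes J_measurable: "\<And>n. J n \<in> measurable M (count_space UNIV)"
    and transition: "\<And>n i j. \<P>(\<omega> in M. J n \<omega> = i) > 0 \<Longrightarrow>
      \<P>(\<omega> in M. J (Suc n) \<omega> = j \<bar> J n \<omega> = i) = P $ i $ j"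
    and markov: "\<And>n i j A.
      \<P>(\<omega> in M. J (Suc n) \<omega> = j \<and> map (\<lambda>l. J l \<omega>) [0..<Suc n] \<in> A \<bar> J n \<omega> = i)
      = \<P>(\<omega> in M. J (Suc n) \<omega> = j \<bar> J n \<omega> = i)
        * \<P>(\<omega> in M. map (\<lambda>l. J l \<omega>) [0..<Suc n] \<in> A \<bar> J n \<omega> = i)"
    and ergodic: "ergodic_mat P"

text \<open>The past at time \<open>n\<close> is \<open>(J\<^sub>0, \<dots>, J\<^sub>n, C\<^sub>1, \<dots>, C\<^sub>n)\<close>; the value \<open>C 0\<close> is never used.
  It takes countably many values, so the events determined by it are exactly
  \<open>past C J n \<omega> \<in> A\<close> for arbitrary sets \<open>A\<close>.\<close>

definition past :: "(nat \<Rightarrow> 'w \<Rightarrow> nat) \<Rightarrow> (nat \<Rightarrow> 'w \<Rightarrow> 'n) \<Rightarrow> nat \<Rightarrow> 'w \<Rightarrow> 'n list \<times> nat list" where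
  "past C J n \<omega> = (map (\<lambda>l. J l \<omega>) [0..<Suc n], map (\<lambda>l. C l \<omega>) [1..<Suc n])"

text \<open>That the matrices \<open>Lam m\<close> are nonnegative and sum to \<open>P\<close> is a consequence of the
  assumptions below: by positivity of \<open>Lam 0\<close> every state has positive probability at
  every time \<open>n \<ge> 1\<close>.\<close>

locale compound_markov_binomial = ergodic_markov_chain M J P
  for M :: "'w measure"
  and J :: "nat \<Rightarrow> 'w \<Rightarrow> 'n::finite"
  and P :: "'n sqmat" +
  fixes C :: "nat \<Rightarrow> 'w \<Rightarrow> nat"
    and Lam :: "nat \<Rightarrow> 'n sqmat"
  assumes C_measurable: "\<And>n. C (Suc n) \<in> measurable M (count_space UNIV)"
    and kernel: "\<And>n i j m. \<P>(\<omega> in M. J n \<omega> = i) > 0 \<Longrightarrow>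
      \<P>(\<omega> in M. C (Suc n) \<omega> = m \<and> J (Suc n) \<omega> = j \<bar> J n \<omega> = i) = Lam m $ i $ j"
    and markov_additive: "\<And>n i j m A.
      \<P>(\<omega> in M. (C (Suc n) \<omega> = m \<and> J (Suc n) \<omega> = j) \<and> past C J n \<omega> \<in> A \<bar> J n \<omega> = i)
      = \<P>(\<omega> in M. C (Suc n) \<omega> = m \<and> J (Suc n) \<omega> = j \<bar> J n \<omega> = i)
        * \<P>(\<omega> in M. past C J n \<omega> \<in> A \<bar> J n \<omega> = i)"
    and Lam0_pos: "\<And>i j. Lam 0 $ i $ j > 0"
    and Lam0_invertible: "invertible (Lam 0)"

definition surplus :: "(nat \<Rightarrow> 'w \<Rightarrow> nat) \<Rightarrow> nat \<Rightarrow> 'w \<Rightarrow> int" where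
  "surplus C n \<omega> = int n - (\<Sum>k=1..n. int (C k \<omega>))"

text \<open>The infimum of the empty set is \<open>\<infinity>\<close>.\<close>

definition upper_hitting_time :: "(nat \<Rightarrow> 'w \<Rightarrow> nat) \<Rightarrow> nat \<Rightarrow> 'w \<Rightarrow> enat" where
  "upper_hitting_time C a \<omega> = Inf (enat ` {n. surplus C n \<omega> \<ge> int a})"


section \<open>The matrix \<open>Q(n, a)\<close>\<close>

text \<open>Only germs at \<open>G = 0\<close> matter below: near \<open>0\<close> the series converges and the entries of
  \<open>Lam_hat\<close> are positive, so that \<open>ln\<close> and \<open>deriv\<close> are not used outside their domain.\<close>

definition Lam_hat :: "(nat \<Rightarrow> 'n::finite sqmat) \<Rightarrow> 'n sqmat \<Rightarrow> 'n sqmat" where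
  "Lam_hat Lam G = (\<Sum>m. Lam m ** mpow G m)"

definition lam_hat :: "(nat \<Rightarrow> 'n::finite sqmat) \<Rightarrow> 'n \<Rightarrow> 'n \<Rightarrow> 'n sqmat \<Rightarrow> real" where
  "lam_hat Lam i j G = Lam_hat Lam G $ i $ j"

text \<open>Partial derivative in the entry \<open>(i, j)\<close>; \<open>axis i (axis j 1)\<close> is the matrix unit.\<close>

definition pderiv_entry ::
  "'n::finite \<Rightarrow> 'n \<Rightarrow> ('n sqmat \<Rightarrow> real) \<Rightarrow> 'n sqmat \<Rightarrow> real" where
  "pderiv_entry i j F G = deriv (\<lambda>t. F (G + t *\<^sub>R axis i (axis j 1))) 0"

definition Gamma_mat :: "(nat \<Rightarrow> 'n::finite sqmat) \<Rightarrow> 'n sqmat \<Rightarrow> real^('n \<times> 'n)^('n \<times> 'n)" where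
  "Gamma_mat Lam G = (\<chi> ij kl. case ij of (i, j) \<Rightarrow> case kl of (k, l) \<Rightarrow>
     G $ i $ j * pderiv_entry k l (\<lambda>H. ln (lam_hat Lam i j H)) G)"

text \<open>The linear order makes the index type a copy of \<open>{1, \<dots>, N}\<close> and fixes the order of
  the operators. The product of the operators \<open>D\<^sub>i\<^sub>j\<close> to the power \<open>x i j\<close> is composition in the order
  \<open>(1,1), (1,2), \<dots>, (N,N)\<close>, with the factor for \<open>(N,N)\<close> applied first.\<close>

definition mixed_deriv ::
  "('n::{finite,linorder} \<Rightarrow> 'n \<Rightarrow> nat) \<Rightarrow> ('n sqmat \<Rightarrow> real) \<Rightarrow> 'n sqmat \<Rightarrow> real" where
  "mixed_deriv x = foldr (\<circ>)
     [pderiv_entry i j ^^ x i j. i \<leftarrow> sorted_list_of_set UNIV, j \<leftarrow> sorted_list_of_set UNIV] id"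

definition B_mat ::
  "(nat \<Rightarrow> 'n sqmat) \<Rightarrow> ('n::{finite,linorder} \<Rightarrow> 'n \<Rightarrow> nat) \<Rightarrow> nat \<Rightarrow> 'n sqmat" where
  "B_mat Lam x a = (\<chi> k l. mixed_deriv x
     (\<lambda>G. mpow G a $ k $ l
          * (\<Prod>i\<in>UNIV. \<Prod>j\<in>UNIV. lam_hat Lam i j G ^ x i j)
          * det (mat 1 - Gamma_mat Lam G)) 0)"

definition Q_mat ::
  "(nat \<Rightarrow> 'n::{finite,linorder} sqmat) \<Rightarrow> nat \<Rightarrow> nat \<Rightarrow> 'n sqmat" where
  "Q_mat Lam n a = (\<Sum>x \<in> {x. (\<Sum>i\<in>UNIV. \<Sum>j\<in>UNIV. x i j) = n}.
     (1 / (\<Prod>i\<in>UNIV. \<Prod>j\<in>UNIV. fact (x i j))) *\<^sub>R B_mat Lam x a)"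

end

theory Submission
  imports Defs
begin

text \<open>The surplus rises by at most one unit per step. So if the first of \<open>n + 1\<close> steps, with a level
  \<open>a + 1\<close> still to climb, brings a claim \<open>m\<close>, then a level \<open>a + m\<close> remains for \<open>n\<close> steps, and the
  matrices \<open>W n a\<close> of first passage probabilities satisfy
  \<open>W (n + 1) (a + 1) = (\<Sum>m\<le>n. \<Lambda>(m) W n (a + m))\<close>, with \<open>W 0 a = (if a = 0 then I else 0)\<close> and
  \<open>W (n + 1) 0 = 0\<close>. This determines \<open>W\<close>, and the proof consists in showing that \<open>Q(n, a)\<close> obeys the
  same recursion; \<open>prob_first_passage\<close> then compares the two along the process.

  Read the entries of \<open>G\<close> as coordinates \<open>u\<^sub>k\<close>, indexed by pairs \<open>k\<close>, and the entries of
  \<open>\<Sum>m. \<Lambda>(m) G\<^sup>m\<close> as power series \<open>g\<^sub>k\<close>. Mixed derivatives at \<open>0\<close> divided by factorials extract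
  coefficients, so an entry of \<open>Q(n, a)\<close> is the value at \<open>f = (G\<^sup>a)\<^sub>i\<^sub>j\<close> of the linear functional
  \<open>L\<^sub>n f = (\<Sum>|x| = n. [u\<^sup>x] f g\<^sup>x det (I - \<Gamma>))\<close>. By Good's version of the multivariate Lagrange formula
  this is the coefficient of \<open>v\<^sup>n\<close> in \<open>f(u(v))\<close>, where \<open>u(v)\<close> solves \<open>u\<^sub>k = v g\<^sub>k(u)\<close>, but the solution
  never has to be constructed. It suffices that \<open>L\<^sub>0 f = f(0)\<close>, that \<open>L\<^sub>n\<^sub>+\<^sub>1 (u\<^sub>k f) = L\<^sub>n (g\<^sub>k f)\<close>
  (\<open>lagrange_coeff_coord_mult\<close>, a shift of exponents), and that \<open>L\<^sub>n\<^sub>+\<^sub>1 1 = 0\<close>. Indeed, the second property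
  applied to \<open>G\<^sup>a\<^sup>+\<^sup>1 = G G\<^sup>a\<close> replaces the left factor \<open>G\<close> by \<open>\<Sum>m. \<Lambda>(m) G\<^sup>m\<close>, of which \<open>L\<^sub>n\<close> sees only the
  terms of degree at most \<open>n\<close>; this is the recursion (\<open>Q_mat_Suc_Suc\<close>).

  The core is \<open>L\<^sub>n\<^sub>+\<^sub>1 1 = 0\<close>: the coefficient of \<open>u\<^sup>x\<close> in \<open>g\<^sup>x det (I - \<Gamma>)\<close> vanishes for \<open>x \<noteq> 0\<close>
  (\<open>weight_matrix_expands\<close>). With \<open>h\<^sub>k = g\<^sub>k\<^sup>x\<^sup>k\<close>, meaning the power with exponent \<open>x\<^sub>k\<close>, the row \<open>k\<close> multiplied
  by \<open>h\<^sub>k\<close> has the entries \<open>\<delta>\<^sub>k\<^sub>l h\<^sub>k - u\<^sub>k \<partial>\<^sub>l h\<^sub>k / x\<^sub>k\<close>, and the determinant does not change if \<open>u\<^sub>k\<close> is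
  replaced by \<open>u\<^sub>l\<close> here. A monomial of \<open>h\<^sub>k\<close> with exponent \<open>\<alpha>\<^sub>k\<close> then contributes
  \<open>\<delta>\<^sub>k\<^sub>l - \<alpha>\<^sub>k\<^sub>l / x\<^sub>k\<close> times itself to the row, and for families with \<open>\<Sum>k. \<alpha>\<^sub>k = x\<close>, the only
  ones that matter, \<open>x\<close> is a left null vector of this numerical matrix. Coordinates with \<open>x\<^sub>k = 0\<close> are
  harmless because no derivative is taken in their direction: on the face \<open>u\<^sub>k = 0\<close> the row \<open>k\<close>
  is a row of the identity.\<close>

text \<open>Absolute summability refers to unordered sums \<open>infsum\<close> throughout.\<close>

no_notation Infinite_Set_Sum.abs_summable_on (infix "abs'_summable'_on" 50)

section \<open>Absolutely convergent power series in several real variables\<close>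

definition deg :: "('k::finite \<Rightarrow> nat) \<Rightarrow> nat" where
  "deg \<alpha> = (\<Sum>k\<in>UNIV. \<alpha> k)"

definition monom_at :: "real^'k::finite \<Rightarrow> ('k \<Rightarrow> nat) \<Rightarrow> real" where
  "monom_at u \<alpha> = (\<Prod>k\<in>UNIV. u $ k ^ \<alpha> k)"

text \<open>Absolute convergence at the corner of the box, where all coordinates equal \<open>r\<close>, dominates the series
  at all points of the box.\<close>

definition expands_on ::
  "real \<Rightarrow> (('k::finite \<Rightarrow> nat) \<Rightarrow> real) \<Rightarrow> (real^'k \<Rightarrow> real) \<Rightarrow> bool" where
  "expands_on r c F \<longleftrightarrow> (\<lambda>\<alpha>. c \<alpha> * r ^ deg \<alpha>) abs_summable_on UNIV \<and>
     (\<forall>u. (\<forall>k. \<bar>u $ k\<bar> \<le> r) \<longrightarrow> ((\<lambda>\<alpha>. c \<alpha> * monom_at u \<alpha>) has_sum F u) UNIV)"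

text \<open>Asking for all sufficiently small radii lets finitely many expansions share a radius without
  taking minima; one positive radius is enough by \<open>expandsI\<close>.\<close>

definition expands :: "(('k::finite \<Rightarrow> nat) \<Rightarrow> real) \<Rightarrow> (real^'k \<Rightarrow> real) \<Rightarrow> bool" where
  "expands c F \<longleftrightarrow> (\<forall>\<^sub>F r in at_right 0. expands_on r c F)"

lemma monom_at_bound:
  assumes "\<And>k. \<bar>u $ k\<bar> \<le> r"
  shows "\<bar>monom_at u \<alpha>\<bar> \<le> r ^ deg \<alpha>"
proof -
  have "\<bar>monom_at u \<alpha>\<bar> = (\<Prod>k\<in>UNIV. \<bar>u $ k\<bar> ^ \<alpha> k)"
    by (simp add: monom_at_def abs_prod power_abs)
  also have "\<dots> \<le> (\<Prod>k\<in>UNIV. r ^ \<alpha> k)"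
    by (intro prod_mono) (auto intro: power_mono assms)
  finally show ?thesis
    by (simp add: deg_def power_sum)
qed

lemma monom_at_0: "monom_at 0 \<alpha> = (if \<alpha> = (\<lambda>_. 0) then 1 else 0)"
  by (auto simp: monom_at_def power_0_left fun_eq_iff)

lemma monom_at_zero_exponent [simp]: "monom_at u (\<lambda>_. 0) = 1"
  by (simp add: monom_at_def)

lemma deg_eq_0_iff [simp]: "deg \<alpha> = 0 \<longleftrightarrow> \<alpha> = (\<lambda>_. 0)"
  by (auto simp: deg_def fun_eq_iff)

lemma monom_at_sum:
  "monom_at u (\<lambda>k. \<Sum>i\<in>I. a i k) = (\<Prod>i\<in>I. monom_at u (a i))"
  by (simp add: monom_at_def power_sum prod.swap[of _ UNIV I])

lemma deg_sum: "deg (\<lambda>k. \<Sum>i\<in>I. a i k) = (\<Sum>i\<in>I. deg (a i))"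
  by (simp add: deg_def sum.swap[of _ UNIV I])

lemma deg_mono: "(\<And>k. \<alpha> k \<le> \<beta> k) \<Longrightarrow> deg \<alpha> \<le> deg \<beta>"
  by (simp add: deg_def sum_mono)

lemma exponent_le_deg: "\<alpha> k \<le> deg \<alpha>"
  by (simp add: deg_def member_le_sum)

lemma finite_exponents_le: "finite {\<alpha> :: 'k::finite \<Rightarrow> nat. \<forall>k. \<alpha> k \<le> \<beta> k}"
proof -
  have "{\<alpha> :: 'k \<Rightarrow> nat. \<forall>k. \<alpha> k \<le> \<beta> k} = PiE UNIV (\<lambda>k. {..\<beta> k})"
    by auto
  then show ?thesis
    by (simp add: finite_PiE)
qed

lemma finite_deg_le: "finite {\<alpha> :: 'k::finite \<Rightarrow> nat. deg \<alpha> \<le> n}"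
  by (rule finite_subset[OF _ finite_exponents_le[of "\<lambda>_. n"]])
     (auto intro: order_trans[OF exponent_le_deg])

lemma finite_deg_eq: "finite {\<alpha> :: 'k::finite \<Rightarrow> nat. deg \<alpha> = n}"
  by (rule finite_subset[OF _ finite_deg_le[of n]]) auto

lemma expands_on_mono:
  assumes "expands_on r c F" "0 \<le> s" "s \<le> r"
  shows "expands_on s c F"
  unfolding expands_on_def
proof (intro conjI allI impI)
  have "(\<lambda>\<alpha>. c \<alpha> * r ^ deg \<alpha>) abs_summable_on UNIV"
    using assms by (simp add: expands_on_def)
  then show "(\<lambda>\<alpha>. c \<alpha> * s ^ deg \<alpha>) abs_summable_on UNIV"
    by (rule Infinite_Sum.abs_summable_on_comparison_test)
       (use assms in \<open>auto simp: abs_mult power_abs intro!: mult_left_mono power_mono\<close>)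
qed (use assms in \<open>auto simp: expands_on_def dest: order_trans\<close>)

lemma expandsI: "expands_on r c F \<Longrightarrow> r > 0 \<Longrightarrow> expands c F"
  unfolding expands_def
  by (rule eventually_at_rightI[of 0 r]) (auto intro: expands_on_mono)

lemma expandsE:
  assumes "expands c F"
  obtains r where "r > 0" "expands_on r c F"
proof -
  have "\<forall>\<^sub>F r in at_right 0. expands_on r c F \<and> r > (0::real)"
    using assms unfolding expands_def by (auto intro: eventually_conj eventually_at_right_less)
  then show ?thesis
    using that eventually_happens[of _ "at_right (0::real)"] by auto
qed

lemma nhds_0_box:
  fixes P :: "real^'k::finite \<Rightarrow> bool"
  assumes "r > 0" "\<And>u. (\<And>k. \<bar>u $ k\<bar> < r) \<Longrightarrow> P u"
  shows "\<forall>\<^sub>F u in nhds 0. P u"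
  unfolding eventually_nhds_metric
  using assms by (auto intro!: exI[of _ r] intro: le_less_trans[OF component_le_norm_cart])

lemma expands_at_0:
  assumes "expands c F"
  shows "F 0 = c (\<lambda>_. 0)"
proof -
  obtain r where r: "r > 0" "expands_on r c F"
    using assms by (rule expandsE)
  have "((\<lambda>\<alpha>. c \<alpha> * monom_at 0 \<alpha>) has_sum F 0) UNIV"
    using r by (auto simp: expands_on_def)
  moreover have "((\<lambda>\<alpha>. c \<alpha> * monom_at 0 \<alpha>) has_sum c (\<lambda>_. 0)) UNIV"
    by (rule has_sum_finite_neutralI[where B = "{\<lambda>_. 0}"]) (auto simp: monom_at_0)
  ultimately show ?thesis
    by (rule has_sum_unique)
qed

subsection \<open>Sums and products\<close>

lemma expands_const: "expands (\<lambda>\<alpha>. if \<alpha> = (\<lambda>_. 0) then a else 0) (\<lambda>_. a)"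
proof (rule expandsI[of 1])
  show "expands_on 1 (\<lambda>\<alpha>. if \<alpha> = (\<lambda>_. 0) then a else 0) (\<lambda>_. a)"
    unfolding expands_on_def
    by (auto intro!: has_sum_finite_neutralI[where B = "{\<lambda>_. 0}"]
          has_sum_imp_summable[OF has_sum_finite_neutralI[where B = "{\<lambda>_. 0}" and c = "\<bar>a\<bar>"]]
          split: if_splits)
qed simp

lemma expands_add:
  assumes "expands c F" "expands d H"
  shows "expands (\<lambda>\<alpha>. c \<alpha> + d \<alpha>) (\<lambda>u. F u + H u)"
proof -
  have *: "\<forall>\<^sub>F r in at_right 0. expands_on r c F \<and> expands_on r d H"
    using assms unfolding expands_def by (rule eventually_conj)
  show ?thesis
    unfolding expands_def using *
  proof eventually_elim
    case (elim r)
    then have "(\<lambda>\<alpha>. norm (c \<alpha> * r ^ deg \<alpha>) + norm (d \<alpha> * r ^ deg \<alpha>)) summable_on UNIV"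
      by (intro summable_on_add) (auto simp: expands_on_def)
    then have "(\<lambda>\<alpha>. (c \<alpha> + d \<alpha>) * r ^ deg \<alpha>) abs_summable_on UNIV"
      by (rule Infinite_Sum.abs_summable_on_comparison_test')
         (metis distrib_right norm_triangle_ineq)
    then show ?case
      using elim unfolding expands_on_def
      by (auto simp: distrib_right intro!: has_sum_add)
  qed
qed

lemma expands_cmult:
  assumes "expands c F"
  shows "expands (\<lambda>\<alpha>. a * c \<alpha>) (\<lambda>u. a * F u)"
  using assms unfolding expands_def
proof eventually_elim
  case (elim r)
  then show ?case
    unfolding expands_on_def
    by (auto simp: mult.assoc abs_mult intro!: has_sum_cmult_right summable_on_cmult_right)
qed

lemma expands_sum:
  assumes "\<And>i. i \<in> I \<Longrightarrow> expands (c i) (F i)"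
  shows "expands (\<lambda>\<alpha>. \<Sum>i\<in>I. c i \<alpha>) (\<lambda>u. \<Sum>i\<in>I. F i u)"
proof (cases "finite I")
  case True
  then show ?thesis
    using assms by (induction I) (use expands_const[of 0] in \<open>auto intro!: expands_add\<close>)
qed (use expands_const[of 0] in auto)

lemma expands_diff:
  assumes "expands c F" "expands d H"
  shows "expands (\<lambda>\<alpha>. c \<alpha> - d \<alpha>) (\<lambda>u. F u - H u)"
  using expands_add[OF assms(1) expands_cmult[OF assms(2), of "-1"]] by simp

text \<open>Multiplying series out leads to absolutely convergent sums of monomials over index sets other than
  the exponents themselves. Collecting the terms with equal exponent makes them power series again.\<close>

lemma expands_on_collect:
  fixes w :: "'b \<Rightarrow> real" and e :: "'b \<Rightarrow> 'k::finite \<Rightarrow> nat"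
  assumes r: "r \<ge> 0"
    and fin: "\<And>\<alpha>. finite {a. e a = \<alpha>}"
    and summable: "(\<lambda>a. w a * r ^ deg (e a)) abs_summable_on UNIV"
    and sums: "\<And>u. (\<And>k. \<bar>u $ k\<bar> \<le> r) \<Longrightarrow> ((\<lambda>a. w a * monom_at u (e a)) has_sum F u) UNIV"
  shows "expands_on r (\<lambda>\<alpha>. \<Sum>a | e a = \<alpha>. w a) F"
  unfolding expands_on_def
proof (intro conjI allI impI)
  let ?S = "Sigma UNIV (\<lambda>\<alpha>. {a. e a = \<alpha>})"
  have bij: "bij_betw snd ?S UNIV"
    by (rule bij_betwI[where g = "\<lambda>a. (e a, a)"]) auto
  {
    fix u :: "real^'k" assume "\<forall>k. \<bar>u $ k\<bar> \<le> r"
    then have "((\<lambda>p. w (snd p) * monom_at u (e (snd p))) has_sum F u) ?S"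
      using sums[of u] has_sum_reindex_bij_betw[OF bij, of "\<lambda>a. w a * monom_at u (e a)"] by simp
    then show "((\<lambda>\<alpha>. (\<Sum>a | e a = \<alpha>. w a) * monom_at u \<alpha>) has_sum F u) UNIV"
      by (rule has_sum_Sigma') (auto simp: sum_distrib_right intro!: has_sum_finiteI fin sum.cong)
  }
  obtain B where "((\<lambda>a. norm (w a * r ^ deg (e a))) has_sum B) UNIV"
    using summable by (auto simp: summable_on_def)
  then have "((\<lambda>p. norm (w (snd p) * r ^ deg (e (snd p)))) has_sum B) ?S"
    using has_sum_reindex_bij_betw[OF bij, of "\<lambda>a. norm (w a * r ^ deg (e a))"] by simp
  then have "((\<lambda>\<alpha>. (\<Sum>a | e a = \<alpha>. \<bar>w a\<bar>) * r ^ deg \<alpha>) has_sum B) UNIV"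
    by (rule has_sum_Sigma')
       (auto simp: sum_distrib_right abs_mult power_abs r intro!: has_sum_finiteI fin sum.cong)
  then show "(\<lambda>\<alpha>. (\<Sum>a | e a = \<alpha>. w a) * r ^ deg \<alpha>) abs_summable_on UNIV"
    by (intro Infinite_Sum.abs_summable_on_comparison_test'[OF has_sum_imp_summable])
       (auto simp: abs_mult power_abs r intro!: mult_right_mono sum_abs)
qed

text \<open>A finite set of families is contained in a finite box, over which the sum of products is a product
  of sums.\<close>

lemma abs_summable_on_prod:
  fixes f :: "'i::finite \<Rightarrow> 'b \<Rightarrow> real"
  assumes "\<And>i. f i abs_summable_on UNIV"
  shows "(\<lambda>a. \<Prod>i\<in>UNIV. f i (a i)) abs_summable_on UNIV"
proof (rule nonneg_bdd_above_summable_on)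
  show "bdd_above (sum (\<lambda>a. norm (\<Prod>i\<in>UNIV. f i (a i))) ` {A. A \<subseteq> UNIV \<and> finite A})"
  proof (rule bdd_aboveI2)
    fix A :: "('i \<Rightarrow> 'b) set" assume "A \<in> {A. A \<subseteq> UNIV \<and> finite A}"
    then have fin: "finite A" by simp
    have "sum (\<lambda>a. norm (\<Prod>i\<in>UNIV. f i (a i))) A
      \<le> sum (\<lambda>a. \<Prod>i\<in>UNIV. norm (f i (a i))) (PiE UNIV (\<lambda>i. (\<lambda>a. a i) ` A))"
      using fin by (auto simp: abs_prod intro!: sum_mono2 finite_PiE prod_nonneg)
    also have "\<dots> = (\<Prod>i\<in>UNIV. \<Sum>b\<in>(\<lambda>a. a i) ` A. norm (f i b))"
      using fin by (subst prod_sum_PiE) auto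
    also have "\<dots> \<le> (\<Prod>i\<in>UNIV. \<Sum>\<^sub>\<infinity>b. norm (f i b))"
      using fin assms by (intro prod_mono) (auto intro!: sum_nonneg finite_sum_le_infsum)
    finally show "sum (\<lambda>a. norm (\<Prod>i\<in>UNIV. f i (a i))) A \<le> (\<Prod>i\<in>UNIV. \<Sum>\<^sub>\<infinity>b. norm (f i b))" .
  qed
qed auto

lemma has_sum_prod:
  fixes f :: "'i::finite \<Rightarrow> 'b \<Rightarrow> real"
  assumes "\<And>i. f i abs_summable_on UNIV" "\<And>i. (f i has_sum s i) UNIV"
  shows "((\<lambda>a. \<Prod>i\<in>UNIV. f i (a i)) has_sum (\<Prod>i\<in>UNIV. s i)) UNIV"
proof -
  have "(\<lambda>a. \<Prod>i\<in>UNIV. f i (a i)) summable_on UNIV"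
    using abs_summable_on_prod[OF assms(1)] by (rule abs_summable_summable)
  moreover have "(\<Sum>\<^sub>\<infinity>a. \<Prod>i\<in>UNIV. f i (a i)) = (\<Prod>i\<in>UNIV. s i)"
    using infsum_prod_PiE_abs[of UNIV f "\<lambda>_. UNIV"] assms by (simp add: infsumI[OF assms(2)])
  ultimately show ?thesis
    by (metis has_sum_infsum)
qed

lemma finite_exponent_families:
  "finite {a :: 'i::finite \<Rightarrow> 'k::finite \<Rightarrow> nat. (\<lambda>k. \<Sum>i\<in>UNIV. a i k) = \<alpha>}"
proof (rule finite_subset)
  show "{a :: 'i \<Rightarrow> 'k \<Rightarrow> nat. (\<lambda>k. \<Sum>i\<in>UNIV. a i k) = \<alpha>} \<subseteq> PiE UNIV (\<lambda>_. {\<beta>. \<forall>k. \<beta> k \<le> \<alpha> k})"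
    by (auto intro!: member_le_sum)
qed (intro finite_PiE finite_exponents_le; simp)

text \<open>The coefficients are sums over families of exponents rather than iterated convolutions: in this
  form the sum over permutations in a determinant can be interchanged with them.\<close>

lemma expands_prod:
  fixes F :: "'i::finite \<Rightarrow> real^'k::finite \<Rightarrow> real"
  assumes "\<And>i. expands (c i) (F i)"
  shows "expands (\<lambda>\<alpha>. \<Sum>a | (\<lambda>k. \<Sum>i\<in>UNIV. a i k) = \<alpha>. \<Prod>i\<in>UNIV. c i (a i))
    (\<lambda>u. \<Prod>i\<in>UNIV. F i u)"
proof -
  have "\<forall>\<^sub>F r in at_right 0. \<forall>i. expands_on r (c i) (F i)"
    using assms by (simp add: expands_def eventually_all_finite)
  then have "\<forall>\<^sub>F r in at_right 0. 0 < r \<and> (\<forall>i. expands_on r (c i) (F i))"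
    by (intro eventually_conj eventually_at_right_less)
  then obtain r where r: "0 < r" "\<And>i. expands_on r (c i) (F i)"
    using eventually_happens[of _ "at_right (0::real)"] by auto
  have "expands_on r (\<lambda>\<alpha>. \<Sum>a | (\<lambda>k. \<Sum>i\<in>UNIV. a i k) = \<alpha>. \<Prod>i\<in>UNIV. c i (a i))
    (\<lambda>u. \<Prod>i\<in>UNIV. F i u)"
  proof (rule expands_on_collect)
    have "(\<lambda>a. \<Prod>i\<in>UNIV. c i (a i) * r ^ deg (a i)) abs_summable_on UNIV"
      by (rule abs_summable_on_prod) (use r in \<open>auto simp: expands_on_def\<close>)
    then show "(\<lambda>a. (\<Prod>i\<in>UNIV. c i (a i)) * r ^ deg (\<lambda>k. \<Sum>i\<in>UNIV. a i k)) abs_summable_on UNIV"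
      by (simp add: deg_sum power_sum prod.distrib)
    fix u :: "real^'k" assume u: "\<And>k. \<bar>u $ k\<bar> \<le> r"
    have "((\<lambda>a. \<Prod>i\<in>UNIV. c i (a i) * monom_at u (a i)) has_sum (\<Prod>i\<in>UNIV. F i u)) UNIV"
    proof (rule has_sum_prod)
      fix i
      show "((\<lambda>\<alpha>. c i \<alpha> * monom_at u \<alpha>) has_sum F i u) UNIV"
        using r(2)[of i] u by (auto simp: expands_on_def)
      have "(\<lambda>\<alpha>. c i \<alpha> * r ^ deg \<alpha>) abs_summable_on UNIV"
        using r by (auto simp: expands_on_def)
      then show "(\<lambda>\<alpha>. c i \<alpha> * monom_at u \<alpha>) abs_summable_on UNIV"
        by (rule Infinite_Sum.abs_summable_on_comparison_test)
           (use monom_at_bound[OF u] r in \<open>auto simp: abs_mult power_abs intro!: mult_left_mono\<close>)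
    qed
    then show "((\<lambda>a. (\<Prod>i\<in>UNIV. c i (a i)) * monom_at u (\<lambda>k. \<Sum>i\<in>UNIV. a i k)) has_sum
        (\<Prod>i\<in>UNIV. F i u)) UNIV"
      by (simp add: monom_at_sum prod.distrib)
  qed (use r finite_exponent_families in auto)
  then show ?thesis
    using r by (intro expandsI)
qed

lemma expands_mult:
  assumes "expands c F" "expands d H"
  shows "expands (\<lambda>\<alpha>. \<Sum>a | (\<lambda>k. a True k + a False k) = \<alpha>. c (a True) * d (a False))
    (\<lambda>u. F u * H u)"
  using expands_prod[of "\<lambda>b. if b then c else d" "\<lambda>b. if b then F else H"] assms
  by (simp add: UNIV_bool ac_simps)

lemma expands_power:
  assumes "expands c F"
  shows "\<exists>d. expands d (\<lambda>u. F u ^ n)"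
  by (induction n) (use assms expands_const[of 1] expands_mult in \<open>auto, blast\<close>)

lemma monom_at_Suc: "monom_at u (\<alpha>(k := Suc (\<alpha> k))) = u $ k * monom_at u \<alpha>"
  unfolding monom_at_def by (subst (1 2) prod.remove[of UNIV k]) (auto intro!: prod.cong)

lemma deg_Suc: "deg (\<alpha>(k := Suc (\<alpha> k))) = Suc (deg \<alpha>)"
  unfolding deg_def by (subst (1 2) sum.remove[of UNIV k]) (auto intro!: sum.cong)

lemma inj_exponent_Suc: "inj (\<lambda>\<alpha>. \<alpha>(k := Suc (\<alpha> k)))"
  by (rule injI) (metis fun_upd_apply fun_upd_triv fun_upd_upd nat.inject)

lemma exponent_Suc_pred: "\<alpha> k \<noteq> 0 \<Longrightarrow> (\<alpha>(k := \<alpha> k - 1))(k := Suc ((\<alpha>(k := \<alpha> k - 1)) k)) = \<alpha>"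
  by auto

lemma expands_coord_mult:
  assumes "expands c F"
  shows "expands (\<lambda>\<alpha>. if \<alpha> k = 0 then 0 else c (\<alpha>(k := \<alpha> k - 1))) (\<lambda>u. u $ k * F u)"
proof -
  obtain r where r: "r > 0" "expands_on r c F"
    using assms by (rule expandsE)
  have "expands_on r (\<lambda>\<alpha>. \<Sum>a | a(k := Suc (a k)) = \<alpha>. c a) (\<lambda>u. u $ k * F u)"
  proof (rule expands_on_collect)
    show "finite {a. a(k := Suc (a k)) = \<alpha>}" for \<alpha>
      using finite_vimageI[OF _ inj_exponent_Suc, of "{\<alpha>}" k] by (simp add: vimage_def)
    have "(\<lambda>a. r * (c a * r ^ deg a)) abs_summable_on UNIV"
      using r by (auto simp: expands_on_def abs_mult intro!: summable_on_cmult_right)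
    then show "(\<lambda>a. c a * r ^ deg (a(k := Suc (a k)))) abs_summable_on UNIV"
      by (simp add: deg_Suc ac_simps)
    show "((\<lambda>a. c a * monom_at u (a(k := Suc (a k)))) has_sum u $ k * F u) UNIV"
      if "\<And>k. \<bar>u $ k\<bar> \<le> r" for u
      using has_sum_cmult_right[of "\<lambda>\<alpha>. c \<alpha> * monom_at u \<alpha>" UNIV "F u" "u $ k"] r that
      by (auto simp: expands_on_def monom_at_Suc ac_simps)
  qed (use r in simp)
  moreover have "(\<Sum>a | a(k := Suc (a k)) = \<alpha>. c a) = (if \<alpha> k = 0 then 0 else c (\<alpha>(k := \<alpha> k - 1)))" for \<alpha>
  proof (cases "\<alpha> k = 0")
    case True
    then have "{a. a(k := Suc (a k)) = \<alpha>} = {}" by auto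
    with True show ?thesis by simp
  next
    case False
    then have "\<alpha>(k := \<alpha> k - 1, k := Suc ((\<alpha>(k := \<alpha> k - 1)) k)) = \<alpha>"
      by (rule exponent_Suc_pred)
    moreover have "a = \<alpha>(k := \<alpha> k - 1)" if "a(k := Suc (a k)) = \<alpha>" for a
      using that by auto
    ultimately have "{a. a(k := Suc (a k)) = \<alpha>} = {\<alpha>(k := \<alpha> k - 1)}"
      by blast
    with False show ?thesis by simp
  qed
  ultimately show ?thesis
    using r by (simp add: expandsI)
qed

subsection \<open>Partial derivatives\<close>

definition partial_deriv :: "'k::finite \<Rightarrow> (real^'k \<Rightarrow> real) \<Rightarrow> real^'k \<Rightarrow> real" where
  "partial_deriv k F u = deriv (\<lambda>t. F (u + t *\<^sub>R axis k 1)) 0"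

definition coeff_deriv :: "'k \<Rightarrow> (('k \<Rightarrow> nat) \<Rightarrow> real) \<Rightarrow> ('k \<Rightarrow> nat) \<Rightarrow> real" where
  "coeff_deriv k c \<alpha> = real (Suc (\<alpha> k)) * c (\<alpha>(k := Suc (\<alpha> k)))"

text \<open>Differentiation multiplies the terms of degree \<open>n\<close> by factors polynomial in \<open>n\<close>, and the gap
  between two radii absorbs these. Writing \<open>r / \<rho>\<close> as a square \<open>(1 + h)\<^sup>2\<close> makes Bernoulli's inequality
  \<open>n h \<le> (1 + h)\<^sup>n\<close> usable twice.\<close>

lemma power_domination:
  fixes \<rho> r :: real
  assumes "0 < \<rho>" "\<rho> < r"
  obtains K where "K \<ge> 0" "\<And>n. real n * \<rho> ^ (n - 1) \<le> K * r ^ n"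
    "\<And>n. real n * real (n - 1) * \<rho> ^ (n - 2) \<le> K * r ^ n"
proof -
  define h where "h = sqrt (r / \<rho>) - 1"
  have h: "h > 0" "r = (1 + h)\<^sup>2 * \<rho>"
    using assms by (auto simp: h_def real_less_rsqrt)
  have Bernoulli: "real n * h \<le> (1 + h) ^ n" for n
    using Bernoulli_inequality[of h n] h by linarith
  have sq: "(real n)\<^sup>2 * \<rho> ^ n \<le> r ^ n / h\<^sup>2" for n
  proof -
    have "(real n * h)\<^sup>2 * \<rho> ^ n \<le> ((1 + h) ^ n)\<^sup>2 * \<rho> ^ n"
      using h(1) assms by (intro mult_right_mono power_mono Bernoulli) auto
    also have "\<dots> = r ^ n"
      by (subst h(2)) (simp only: power_mult_distrib power_mult[symmetric] mult.commute[of n 2])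
    finally show ?thesis
      using h(1) by (simp add: power_mult_distrib pos_le_divide_eq ac_simps)
  qed
  define K where "K = 1 / (h\<^sup>2 * \<rho>) + 1 / (h\<^sup>2 * \<rho>\<^sup>2)"
  show ?thesis
  proof
    show "K \<ge> 0"
      using assms by (simp add: K_def)
    fix n
    have rn: "r ^ n \<ge> 0" using assms by simp
    show "real n * \<rho> ^ (n - 1) \<le> K * r ^ n"
    proof (cases n)
      case (Suc m)
      have "real n * \<rho> ^ (n - 1) \<le> (real n)\<^sup>2 * \<rho> ^ (n - 1)"
        using assms Suc by (intro mult_right_mono) (auto simp: power2_eq_square)
      also have "\<dots> = ((real n)\<^sup>2 * \<rho> ^ n) / \<rho>"
        using assms by (simp add: Suc)
      also have "\<dots> \<le> r ^ n / h\<^sup>2 / \<rho>"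
        using assms by (intro divide_right_mono sq) auto
      also have "\<dots> \<le> K * r ^ n"
        using assms rn by (simp add: K_def distrib_right)
      finally show ?thesis .
    qed (use assms in \<open>simp add: K_def\<close>)
    show "real n * real (n - 1) * \<rho> ^ (n - 2) \<le> K * r ^ n"
    proof (cases "n \<ge> 2")
      case True
      then obtain m where m: "n = Suc (Suc m)"
        by (metis Suc_le_D numeral_2_eq_2 Suc_le_mono)
      have "real n * real (n - 1) * \<rho> ^ (n - 2) \<le> (real n)\<^sup>2 * \<rho> ^ (n - 2)"
        using assms unfolding power2_eq_square by (intro mult_mono) auto
      also have "\<dots> = ((real n)\<^sup>2 * \<rho> ^ n) / \<rho>\<^sup>2"
        using assms by (simp add: m power2_eq_square)
      also have "\<dots> \<le> r ^ n / h\<^sup>2 / \<rho>\<^sup>2"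
        using assms by (intro divide_right_mono sq) auto
      also have "\<dots> \<le> K * r ^ n"
        using assms rn by (simp add: K_def distrib_right)
      finally show ?thesis .
    next
      case False
      then have "n = 0 \<or> n = 1" by auto
      with \<open>K \<ge> 0\<close> rn show ?thesis by auto
    qed
  qed
qed

lemma monom_at_update:
  "monom_at (u + t *\<^sub>R axis k 1) \<alpha> = (u $ k + t) ^ \<alpha> k * (\<Prod>j\<in>UNIV - {k}. u $ j ^ \<alpha> j)"
proof -
  have "(\<Prod>j\<in>UNIV - {k}. (u + t *\<^sub>R axis k 1) $ j ^ \<alpha> j) = (\<Prod>j\<in>UNIV - {k}. u $ j ^ \<alpha> j)"
    by (intro prod.cong) (auto simp: axis_def)
  then show ?thesis
    unfolding monom_at_def by (subst prod.remove[of UNIV k]) (auto simp: axis_def)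
qed

lemma has_sum_minus:
  fixes f g :: "'b \<Rightarrow> real"
  shows "(f has_sum a) A \<Longrightarrow> (g has_sum b) A \<Longrightarrow> ((\<lambda>x. f x - g x) has_sum (a - b)) A"
  using has_sum_add[of f A a "\<lambda>x. - g x" "- b"] has_sum_uminusI[of g A b] by simp

lemma norm_has_sum_le:
  fixes f :: "'b \<Rightarrow> 'c::real_normed_vector"
  assumes f: "(f has_sum S) A" and g: "(g has_sum T) A"
    and le: "\<And>x. norm (f x) \<le> g x"
  shows "norm S \<le> T"
proof -
  have "(\<lambda>x. norm (f x)) summable_on A"
    by (rule Infinite_Sum.abs_summable_on_comparison_test'[OF has_sum_imp_summable[OF g]]) (rule le)
  then obtain N where N: "((\<lambda>x. norm (f x)) has_sum N) A"
    by (auto simp: summable_on_def)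
  have "norm S \<le> N"
    by (rule norm_has_sum_bound[OF N f])
  also have "N \<le> T"
    by (rule has_sum_mono[OF N g]) (rule le)
  finally show ?thesis .
qed

text \<open>The difference quotient of a monomial approximates its derivative uniformly enough
  to be summed against the coefficients.\<close>

lemma monom_at_difference_quotient:
  assumes u: "\<And>j. \<bar>u $ j\<bar> \<le> \<rho>" and t: "t \<noteq> 0" "\<bar>u $ k + t\<bar> \<le> \<rho>"
  shows "\<bar>(monom_at (u + t *\<^sub>R axis k 1) \<alpha> - monom_at u \<alpha>) / t
          - real (\<alpha> k) * monom_at u (\<alpha>(k := \<alpha> k - 1))\<bar>
         \<le> real (deg \<alpha>) * real (deg \<alpha> - 1) * \<rho> ^ (deg \<alpha> - 2) * \<bar>t\<bar>"
proof -
  let ?R = "\<Prod>j\<in>UNIV - {k}. u $ j ^ \<alpha> j" and ?n = "\<alpha> k"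
  let ?m = "\<Sum>j\<in>UNIV - {k}. \<alpha> j"
  have \<rho>: "\<rho> \<ge> 0"
    using u[of k] by linarith
  have deg: "deg \<alpha> = ?n + ?m"
    unfolding deg_def by (subst sum.remove[of UNIV k]) auto
  have "monom_at u (\<alpha>(k := ?n - 1)) = u $ k ^ (?n - 1) * ?R"
    unfolding monom_at_def by (subst prod.remove[of UNIV k]) (auto intro!: prod.cong)
  moreover have "monom_at u \<alpha> = u $ k ^ ?n * ?R"
    unfolding monom_at_def by (subst prod.remove[of UNIV k]) auto
  ultimately have "(monom_at (u + t *\<^sub>R axis k 1) \<alpha> - monom_at u \<alpha>) / t
          - real ?n * monom_at u (\<alpha>(k := ?n - 1))
    = (((u $ k + t) ^ ?n - u $ k ^ ?n) / t - real ?n * u $ k ^ (?n - Suc 0)) * ?R"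
    by (simp add: monom_at_update field_simps t)
  also have "\<bar>\<dots>\<bar> \<le> (real ?n * real (?n - Suc 0) * \<rho> ^ (?n - 2) * \<bar>t\<bar>) * \<rho> ^ ?m"
    unfolding abs_mult
  proof (rule mult_mono)
    show "\<bar>((u $ k + t) ^ ?n - u $ k ^ ?n) / t - real ?n * u $ k ^ (?n - Suc 0)\<bar>
        \<le> real ?n * real (?n - Suc 0) * \<rho> ^ (?n - 2) * \<bar>t\<bar>"
      using lemma_termdiff3[of t "u $ k" \<rho> ?n] t u[of k] by simp
    have "\<bar>?R\<bar> \<le> (\<Prod>j\<in>UNIV - {k}. \<rho> ^ \<alpha> j)"
      unfolding abs_prod power_abs by (intro prod_mono) (auto intro!: power_mono u)
    then show "\<bar>?R\<bar> \<le> \<rho> ^ ?m"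
      by (simp add: power_sum)
  qed (use \<rho> in auto)
  also have "\<dots> \<le> real (deg \<alpha>) * real (deg \<alpha> - 1) * \<rho> ^ (deg \<alpha> - 2) * \<bar>t\<bar>"
  proof (cases "?n \<ge> 2")
    case True
    then have "\<rho> ^ (?n - 2) * \<rho> ^ ?m = \<rho> ^ (deg \<alpha> - 2)"
      by (simp add: deg flip: power_add)
    then have "(real ?n * real (?n - Suc 0) * \<rho> ^ (?n - 2) * \<bar>t\<bar>) * \<rho> ^ ?m
      = real ?n * real (?n - 1) * \<rho> ^ (deg \<alpha> - 2) * \<bar>t\<bar>"
      by (simp add: ac_simps)
    also have "\<dots> \<le> real (deg \<alpha>) * real (deg \<alpha> - 1) * \<rho> ^ (deg \<alpha> - 2) * \<bar>t\<bar>"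
      using \<rho> by (intro mult_right_mono mult_mono) (simp_all add: deg del: of_nat_add of_nat_sum)
    finally show ?thesis .
  next
    case False
    then have "?n = 0 \<or> ?n = 1" by auto
    then show ?thesis using \<rho> by auto
  qed
  finally show ?thesis .
qed

text \<open>Raising the exponent of \<open>k\<close> is injective and misses only the exponents without \<open>k\<close>, where the
  summand vanishes.\<close>

lemma sum_with_exponent_factor:
  assumes "\<And>\<alpha>. \<alpha> k = 0 \<Longrightarrow> f \<alpha> = 0"
  shows "(f has_sum S) UNIV \<longleftrightarrow> ((\<lambda>\<alpha>. f (\<alpha>(k := Suc (\<alpha> k)))) has_sum S) UNIV"
proof -
  have "\<alpha> \<in> range (\<lambda>\<alpha>. \<alpha>(k := Suc (\<alpha> k)))" if "\<alpha> k \<noteq> 0" for \<alpha> :: "'a \<Rightarrow> nat"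
    using exponent_Suc_pred[of \<alpha> k] that by (intro image_eqI[of _ _ "\<alpha>(k := \<alpha> k - 1)"]) simp_all
  then have "(f has_sum S) UNIV \<longleftrightarrow> (f has_sum S) (range (\<lambda>\<alpha>. \<alpha>(k := Suc (\<alpha> k))))"
    using assms by (intro has_sum_cong_neutral) auto
  also have "\<dots> \<longleftrightarrow> ((\<lambda>\<alpha>. f (\<alpha>(k := Suc (\<alpha> k)))) has_sum S) UNIV"
    by (subst has_sum_reindex[OF inj_exponent_Suc]) (simp add: o_def)
  finally show ?thesis .
qed

text \<open>Termwise differentiation. The difference quotient of the whole series differs from the termwise
  derivative by at most a constant times \<open>|t|\<close>; the constant is finite because the points involved stay
  within a radius \<open>\<rho>\<close> strictly between \<open>s\<close> and \<open>r\<close>.\<close>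

lemma expands_on_partial_deriv:
  assumes F: "expands_on r c F" and s: "0 < s" "s < r"
  shows "\<And>u. (\<And>j. \<bar>u $ j\<bar> \<le> s) \<Longrightarrow>
      ((\<lambda>t. F (u + t *\<^sub>R axis k 1)) has_field_derivative partial_deriv k F u) (at 0)"
    and "expands_on s (coeff_deriv k c) (partial_deriv k F)"
proof -
  have Fsummable: "(\<lambda>\<alpha>. \<bar>c \<alpha>\<bar> * r ^ deg \<alpha>) summable_on UNIV"
    using F s by (simp add: expands_on_def abs_mult power_abs)
  define B where "B = (\<Sum>\<^sub>\<infinity>\<alpha>. \<bar>c \<alpha>\<bar> * r ^ deg \<alpha>)"
  have B: "((\<lambda>\<alpha>. \<bar>c \<alpha>\<bar> * r ^ deg \<alpha>) has_sum B) UNIV"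
    unfolding B_def using Fsummable by simp
  \<comment> \<open>The radius that leaves room for \<open>u + t *\<^sub>R axis k 1\<close> with small \<open>t\<close>.\<close>
  define \<rho> where "\<rho> = (s + r) / 2"
  have \<rho>: "s < \<rho>" "\<rho> < r" "0 < \<rho>"
    using s by (auto simp: \<rho>_def)
  obtain K where K: "K \<ge> 0" "\<And>n. real n * \<rho> ^ (n - 1) \<le> K * r ^ n"
    "\<And>n. real n * real (n - 1) * \<rho> ^ (n - 2) \<le> K * r ^ n"
    using power_domination[OF \<rho>(3,2)] by blast
  define f where "f u \<alpha> = c \<alpha> * (real (\<alpha> k) * monom_at u (\<alpha>(k := \<alpha> k - 1)))" for u \<alpha>
  have deg_pred: "deg (\<alpha>(k := \<alpha> k - 1)) = deg \<alpha> - 1" if "\<alpha> k \<noteq> 0" for \<alpha>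
    using deg_Suc[of "\<alpha>(k := \<alpha> k - 1)" k] unfolding exponent_Suc_pred[of \<alpha> k, OF that] by simp
  have dom: "\<bar>real (\<alpha> k)\<bar> * s ^ deg (\<alpha>(k := \<alpha> k - 1)) \<le> K * r ^ deg \<alpha>" for \<alpha>
  proof (cases "\<alpha> k = 0")
    case False
    have "real (\<alpha> k) * s ^ (deg \<alpha> - 1) \<le> real (deg \<alpha>) * \<rho> ^ (deg \<alpha> - 1)"
      using s \<rho> by (intro mult_mono power_mono) (auto simp: exponent_le_deg)
    with K(2)[of "deg \<alpha>"] show ?thesis
      using deg_pred[of \<alpha>] False by simp
  qed (use K s in simp)
  have f_reindex: "f u (\<alpha>(k := Suc (\<alpha> k))) = coeff_deriv k c \<alpha> * monom_at u \<alpha>" for u \<alpha>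
    by (simp add: f_def coeff_deriv_def)
  have f_sums: "((\<lambda>\<alpha>. coeff_deriv k c \<alpha> * monom_at u \<alpha>) has_sum infsum (f u) UNIV) UNIV \<and>
      (f u has_sum infsum (f u) UNIV) UNIV"
    if u: "\<And>j. \<bar>u $ j\<bar> \<le> s" for u
  proof -
    have "f u abs_summable_on UNIV"
    proof (rule Infinite_Sum.abs_summable_on_comparison_test')
      show "(\<lambda>\<alpha>. K * (\<bar>c \<alpha>\<bar> * r ^ deg \<alpha>)) summable_on UNIV"
        using Fsummable by (rule summable_on_cmult_right)
      fix \<alpha> :: "'a \<Rightarrow> nat"
      have "\<bar>real (\<alpha> k)\<bar> * \<bar>monom_at u (\<alpha>(k := \<alpha> k - 1))\<bar> \<le> K * r ^ deg \<alpha>"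
        by (rule order_trans[OF mult_left_mono[OF monom_at_bound[OF u]] dom]) simp
      from mult_left_mono[OF this, of "\<bar>c \<alpha>\<bar>"] show "norm (f u \<alpha>) \<le> K * (\<bar>c \<alpha>\<bar> * r ^ deg \<alpha>)"
        by (simp add: f_def abs_mult ac_simps)
    qed
    then have "(f u has_sum infsum (f u) UNIV) UNIV"
      by (rule has_sum_infsum[OF abs_summable_summable])
    moreover have "f u \<alpha> = 0" if "\<alpha> k = 0" for \<alpha>
      by (simp add: f_def that)
    ultimately show ?thesis
      using sum_with_exponent_factor[of k "f u" "infsum (f u) UNIV"] by (simp add: f_reindex)
  qed
  have deriv: "((\<lambda>t. F (u + t *\<^sub>R axis k 1)) has_field_derivative infsum (f u) UNIV) (at 0)"
    if u: "\<And>j. \<bar>u $ j\<bar> \<le> s" for u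
  proof -
    have bound: "\<bar>(F (u + t *\<^sub>R axis k 1) - F u) / t - infsum (f u) UNIV\<bar> \<le> B * K * \<bar>t\<bar>"
      if t: "t \<noteq> 0" "\<bar>t\<bar> \<le> \<rho> - s" for t
    proof -
      have ut: "\<bar>(u + t *\<^sub>R axis k 1) $ j\<bar> \<le> r" for j
        using u[of j] t \<rho> by (auto simp: axis_def)
      have u\<rho>: "\<bar>u $ k + t\<bar> \<le> \<rho>" "\<bar>u $ j\<bar> \<le> \<rho>" for j
        using u[of k] u[of j] t \<rho> by linarith+
      have quot: "\<bar>(monom_at (u + t *\<^sub>R axis k 1) \<alpha> - monom_at u \<alpha>) / t
          - real (\<alpha> k) * monom_at u (\<alpha>(k := \<alpha> k - 1))\<bar> \<le> K * r ^ deg \<alpha> * \<bar>t\<bar>" for \<alpha>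
        by (rule order_trans[OF monom_at_difference_quotient[OF u\<rho>(2) t(1) u\<rho>(1)] mult_right_mono[OF K(3)]]) simp
      have "((\<lambda>\<alpha>. 1 / t * (c \<alpha> * monom_at (u + t *\<^sub>R axis k 1) \<alpha> - c \<alpha> * monom_at u \<alpha>) - f u \<alpha>)
        has_sum 1 / t * (F (u + t *\<^sub>R axis k 1) - F u) - infsum (f u) UNIV) UNIV"
      proof (intro has_sum_minus has_sum_cmult_right)
        have "\<bar>u $ j\<bar> \<le> r" for j
          using u[of j] s by linarith
        then show "((\<lambda>\<alpha>. c \<alpha> * monom_at u \<alpha>) has_sum F u) UNIV"
          using F by (simp add: expands_on_def)
        show "((\<lambda>\<alpha>. c \<alpha> * monom_at (u + t *\<^sub>R axis k 1) \<alpha>) has_sum F (u + t *\<^sub>R axis k 1)) UNIV"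
          using F ut unfolding expands_on_def by blast
        show "(f u has_sum infsum (f u) UNIV) UNIV"
          using f_sums[OF u] by simp
      qed
      moreover have "((\<lambda>\<alpha>. K * \<bar>t\<bar> * (\<bar>c \<alpha>\<bar> * r ^ deg \<alpha>)) has_sum (K * \<bar>t\<bar> * B)) UNIV"
        using B by (rule has_sum_cmult_right)
      moreover have "norm (1 / t * (c \<alpha> * monom_at (u + t *\<^sub>R axis k 1) \<alpha> - c \<alpha> * monom_at u \<alpha>) - f u \<alpha>)
          \<le> K * \<bar>t\<bar> * (\<bar>c \<alpha>\<bar> * r ^ deg \<alpha>)" for \<alpha>
      proof -
        have "1 / t * (c \<alpha> * monom_at (u + t *\<^sub>R axis k 1) \<alpha> - c \<alpha> * monom_at u \<alpha>) - f u \<alpha>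
          = c \<alpha> * ((monom_at (u + t *\<^sub>R axis k 1) \<alpha> - monom_at u \<alpha>) / t
          - real (\<alpha> k) * monom_at u (\<alpha>(k := \<alpha> k - 1)))"
          using t(1) by (simp add: f_def field_simps)
        then show ?thesis
          using mult_left_mono[OF quot, of "\<bar>c \<alpha>\<bar>" \<alpha>] by (simp add: abs_mult ac_simps)
      qed
      ultimately have "norm (1 / t * (F (u + t *\<^sub>R axis k 1) - F u) - infsum (f u) UNIV) \<le> K * \<bar>t\<bar> * B"
        by (rule norm_has_sum_le)
      then show ?thesis
        by (simp add: ac_simps)
    qed
    have "((\<lambda>t. (F (u + t *\<^sub>R axis k 1) - F u) / t - infsum (f u) UNIV) \<longlongrightarrow> 0) (at 0)"
    proof (rule Lim_null_comparison)
      show "\<forall>\<^sub>F t in at 0. norm ((F (u + t *\<^sub>R axis k 1) - F u) / t - infsum (f u) UNIV) \<le> B * K * \<bar>t\<bar>"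
        unfolding eventually_at using \<rho> bound by (auto intro!: exI[of _ "\<rho> - s"])
      show "((\<lambda>t. B * K * \<bar>t\<bar>) \<longlongrightarrow> 0) (at 0)"
        by (auto intro!: tendsto_eq_intros)
    qed
    then show ?thesis
      unfolding has_field_derivative_iff using Lim_null by fastforce
  qed
  have deriv_eq: "partial_deriv k F u = infsum (f u) UNIV" if "\<And>j. \<bar>u $ j\<bar> \<le> s" for u
    unfolding partial_deriv_def using deriv[OF that] by (rule DERIV_imp_deriv)
  show "((\<lambda>t. F (u + t *\<^sub>R axis k 1)) has_field_derivative partial_deriv k F u) (at 0)"
    if "\<And>j. \<bar>u $ j\<bar> \<le> s" for u
    unfolding deriv_eq[OF that] by (rule deriv[OF that])
  show "expands_on s (coeff_deriv k c) (partial_deriv k F)"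
    unfolding expands_on_def
  proof (intro conjI allI impI)
    have "((\<lambda>\<alpha>. coeff_deriv k c \<alpha> * monom_at (\<chi> j. s) \<alpha>) summable_on UNIV)"
      using has_sum_imp_summable[OF conjunct1[OF f_sums[of "\<chi> j. s"]]] s by simp
    then show "(\<lambda>\<alpha>. coeff_deriv k c \<alpha> * s ^ deg \<alpha>) abs_summable_on UNIV"
      unfolding summable_on_iff_abs_summable_on_real[symmetric]
      by (simp add: monom_at_def deg_def power_sum)
    show "((\<lambda>\<alpha>. coeff_deriv k c \<alpha> * monom_at u \<alpha>) has_sum partial_deriv k F u) UNIV"
      if "\<forall>j. \<bar>u $ j\<bar> \<le> s" for u
      unfolding deriv_eq[OF that[rule_format]] using f_sums[OF that[rule_format]] by (rule conjunct1)
  qed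
qed

lemma expands_partial_deriv:
  assumes "expands c F"
  shows "expands (coeff_deriv k c) (partial_deriv k F)"
proof -
  obtain r where r: "r > 0" "expands_on r c F"
    using assms by (rule expandsE)
  show ?thesis
    using expandsI[OF expands_on_partial_deriv(2)[OF r(2), of "r / 2"]] r(1) by simp
qed

lemma expands_DERIV:
  assumes "expands c F"
  shows "\<forall>\<^sub>F u in nhds 0. ((\<lambda>t. F (u + t *\<^sub>R axis k 1)) has_field_derivative partial_deriv k F u) (at 0)"
proof -
  obtain r where r: "r > 0" "expands_on r c F"
    using assms by (rule expandsE)
  show ?thesis
  proof (rule nhds_0_box[of "r / 2"])
    show "((\<lambda>t. F (u + t *\<^sub>R axis k 1)) has_field_derivative partial_deriv k F u) (at 0)"
      if "\<And>j. \<bar>u $ j\<bar> < r / 2" for u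
      by (rule expands_on_partial_deriv(1)[OF r(2), of "r / 2"]) (use r that in \<open>auto intro: less_imp_le\<close>)
  qed (use r in simp)
qed

text \<open>Every monomial other than the constant one is, on the box, at most \<open>|u| / r\<close> times its value at the corner.\<close>

lemma expands_continuous_at_0:
  assumes "expands c F"
  shows "(F \<longlongrightarrow> F 0) (nhds 0)"
proof -
  obtain r where r: "r > 0" "expands_on r c F"
    using assms by (rule expandsE)
  define B where "B = (\<Sum>\<^sub>\<infinity>\<alpha>. \<bar>c \<alpha>\<bar> * r ^ deg \<alpha>)"
  have B: "((\<lambda>\<alpha>. \<bar>c \<alpha>\<bar> * r ^ deg \<alpha>) has_sum B) UNIV"
    using r by (simp add: B_def expands_on_def abs_mult power_abs)
  have bound: "norm (F u - F 0) \<le> norm u / r * B" if u: "norm u \<le> r" for u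
  proof (rule norm_has_sum_le)
    have box: "\<bar>u $ k\<bar> \<le> norm u" for k
      by (rule component_le_norm_cart)
    have "\<bar>u $ k\<bar> \<le> r" for k
      using u box[of k] by linarith
    then have "((\<lambda>\<alpha>. c \<alpha> * monom_at u \<alpha>) has_sum F u) UNIV"
      "((\<lambda>\<alpha>. c \<alpha> * monom_at 0 \<alpha>) has_sum F 0) UNIV"
      using r by (auto simp: expands_on_def)
    then show "((\<lambda>\<alpha>. c \<alpha> * monom_at u \<alpha> - c \<alpha> * monom_at 0 \<alpha>) has_sum F u - F 0) UNIV"
      by (rule has_sum_minus)
    show "((\<lambda>\<alpha>. norm u / r * (\<bar>c \<alpha>\<bar> * r ^ deg \<alpha>)) has_sum norm u / r * B) UNIV"
      using B by (rule has_sum_cmult_right)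
    fix \<alpha> :: "'a \<Rightarrow> nat"
    show "norm (c \<alpha> * monom_at u \<alpha> - c \<alpha> * monom_at 0 \<alpha>) \<le> norm u / r * (\<bar>c \<alpha>\<bar> * r ^ deg \<alpha>)"
    proof (cases "\<alpha> = (\<lambda>_. 0)")
      case True
      then show ?thesis using r by simp
    next
      case False
      then obtain m where m: "deg \<alpha> = Suc m"
        by (metis deg_eq_0_iff not0_implies_Suc)
      have "\<bar>monom_at u \<alpha>\<bar> \<le> norm u ^ deg \<alpha>"
        by (rule monom_at_bound) (rule box)
      also have "\<dots> = norm u * norm u ^ m"
        by (simp add: m)
      also have "\<dots> \<le> norm u * r ^ m"
        using u by (intro mult_left_mono power_mono) auto
      also have "\<dots> = norm u / r * r ^ deg \<alpha>"
        using r by (simp add: m)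
      finally have "\<bar>c \<alpha>\<bar> * \<bar>monom_at u \<alpha>\<bar> \<le> \<bar>c \<alpha>\<bar> * (norm u / r * r ^ deg \<alpha>)"
        by (rule mult_left_mono) simp
      then show ?thesis
        using False by (simp add: monom_at_0 abs_mult ac_simps)
    qed
  qed
  have "((\<lambda>u. F u - F 0) \<longlongrightarrow> 0) (nhds 0)"
  proof (rule Lim_null_comparison)
    show "\<forall>\<^sub>F u in nhds 0. norm (F u - F 0) \<le> norm u / r * B"
      unfolding eventually_nhds_metric using r bound by (auto intro!: exI[of _ r])
    have "((\<lambda>u::real^'a. norm u / r * B) \<longlongrightarrow> norm (0::real^'a) / r * B) (nhds 0)"
      using r by (intro tendsto_intros filterlim_ident) auto
    then show "((\<lambda>u::real^'a. norm u / r * B) \<longlongrightarrow> 0) (nhds 0)"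
      by simp
  qed
  then show ?thesis
    by (simp add: Lim_null[symmetric])
qed

subsection \<open>Coefficients as mixed partial derivatives\<close>

text \<open>A derivative along a direction inside a coordinate face, taken at a point of the face, depends only on values
  on the face.\<close>

lemma partial_deriv_cong_on_face:
  fixes F H :: "real^'k::finite \<Rightarrow> real"
  assumes ev: "\<forall>\<^sub>F u in nhds 0. (\<forall>j\<in>Z. u $ j = 0) \<longrightarrow> F u = H u" and k: "k \<notin> Z"
  shows "\<forall>\<^sub>F u in nhds 0. (\<forall>j\<in>Z. u $ j = 0) \<longrightarrow> partial_deriv k F u = partial_deriv k H u"
proof -
  have "\<forall>\<^sub>F v in nhds 0. \<forall>\<^sub>F u in nhds v. (\<forall>j\<in>Z. u $ j = 0) \<longrightarrow> F u = H u"
    using ev by (simp add: eventually_eventually)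
  then show ?thesis
  proof eventually_elim
    case (elim v)
    show ?case
    proof
      assume v: "\<forall>j\<in>Z. v $ j = 0"
      have "((\<lambda>t. v + t *\<^sub>R axis k 1) \<longlongrightarrow> v + 0 *\<^sub>R axis k 1) (nhds 0)"
        by (intro tendsto_intros filterlim_ident)
      then have "filterlim (\<lambda>t. v + t *\<^sub>R axis k 1) (nhds v) (nhds 0)"
        by simp
      from eventually_compose_filterlim[OF elim this]
      have "\<forall>\<^sub>F t in nhds 0. (\<forall>j\<in>Z. (v + t *\<^sub>R axis k 1) $ j = 0) \<longrightarrow>
          F (v + t *\<^sub>R axis k 1) = H (v + t *\<^sub>R axis k 1)"
        .
      moreover have "(v + t *\<^sub>R axis k 1) $ j = 0" if "j \<in> Z" for t j
        using v k that by (auto simp: axis_def)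
      ultimately have "\<forall>\<^sub>F t in nhds 0. F (v + t *\<^sub>R axis k 1) = H (v + t *\<^sub>R axis k 1)"
        by simp
      then show "partial_deriv k F v = partial_deriv k H v"
        unfolding partial_deriv_def by (rule deriv_cong_ev) simp
    qed
  qed
qed

lemma coeff_deriv_funpow:
  "(coeff_deriv k ^^ n) c \<alpha> = fact (\<alpha> k + n) / fact (\<alpha> k) * c (\<alpha>(k := \<alpha> k + n))"
proof (induction n arbitrary: \<alpha>)
  case (Suc n)
  have "(coeff_deriv k ^^ Suc n) c \<alpha> = real (Suc (\<alpha> k)) * (coeff_deriv k ^^ n) c (\<alpha>(k := Suc (\<alpha> k)))"
    by (simp add: coeff_deriv_def)
  also have "\<dots> = fact (\<alpha> k + Suc n) / fact (\<alpha> k) * c (\<alpha>(k := \<alpha> k + Suc n))"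
    by (simp add: Suc.IH fun_upd_same del: of_nat_Suc fun_upd_apply)
  finally show ?case .
qed simp

lemma foldr_coeff_deriv:
  assumes "distinct ks" "\<And>k. k \<in> set ks \<Longrightarrow> \<beta> k = 0"
  shows "foldr (\<lambda>k. coeff_deriv k ^^ \<alpha> k) ks c \<beta>
    = (\<Prod>k\<leftarrow>ks. fact (\<alpha> k)) * c (\<lambda>k. if k \<in> set ks then \<alpha> k else \<beta> k)"
  using assms
proof (induction ks arbitrary: \<beta>)
  case (Cons k ks)
  have "foldr (\<lambda>k. coeff_deriv k ^^ \<alpha> k) (k # ks) c \<beta>
    = fact (\<alpha> k) * foldr (\<lambda>k. coeff_deriv k ^^ \<alpha> k) ks c (\<beta>(k := \<alpha> k))"
    using Cons.prems by (simp add: coeff_deriv_funpow)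
  also have "foldr (\<lambda>k. coeff_deriv k ^^ \<alpha> k) ks c (\<beta>(k := \<alpha> k))
    = (\<Prod>k\<leftarrow>ks. fact (\<alpha> k)) * c (\<lambda>j. if j \<in> set ks then \<alpha> j else (\<beta>(k := \<alpha> k)) j)"
    using Cons.prems by (intro Cons.IH) auto
  also have "(\<lambda>j. if j \<in> set ks then \<alpha> j else (\<beta>(k := \<alpha> k)) j)
    = (\<lambda>j. if j \<in> set (k # ks) then \<alpha> j else \<beta> j)"
    by auto
  finally show ?case
    by simp
qed simp

text \<open>The coordinates are listed in the order in which the derivatives are composed.\<close>

definition taylor_coeff :: "'k::finite list \<Rightarrow> ('k \<Rightarrow> nat) \<Rightarrow> (real^'k \<Rightarrow> real) \<Rightarrow> real" where
  "taylor_coeff ks \<alpha> F = foldr (\<lambda>k. partial_deriv k ^^ \<alpha> k) ks F 0 / (\<Prod>k\<in>UNIV. fact (\<alpha> k))"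

locale coordinate_list =
  fixes ks :: "'k::finite list"
  assumes distinct: "distinct ks" and all: "set ks = UNIV"
begin

text \<open>Each derivative acts on the coefficient sequence, and evaluation at \<open>0\<close> finally picks the constant
  term, whatever the order of the coordinates.\<close>

lemma taylor_coeff_expands:
  assumes "expands c F"
  shows "taylor_coeff ks \<alpha> F = c \<alpha>"
proof -
  have pow: "expands ((coeff_deriv k ^^ n) d) ((partial_deriv k ^^ n) H)" if "expands d H" for k n d and H :: "real^'k \<Rightarrow> real"
    using that by (induction n) (auto intro: expands_partial_deriv)
  have "expands (foldr (\<lambda>k. coeff_deriv k ^^ \<alpha> k) js c) (foldr (\<lambda>k. partial_deriv k ^^ \<alpha> k) js F)" for js
    using assms by (induction js) (auto intro: pow)
  from expands_at_0[OF this[of ks]]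
  have "foldr (\<lambda>k. partial_deriv k ^^ \<alpha> k) ks F 0 = (\<Prod>k\<leftarrow>ks. fact (\<alpha> k)) * c \<alpha>"
    by (simp add: foldr_coeff_deriv distinct all)
  moreover have "(\<Prod>k\<leftarrow>ks. fact (\<alpha> k)) = (\<Prod>k\<in>UNIV. fact (\<alpha> k) :: real)"
    using prod.distinct_set_conv_list[OF distinct, of "\<lambda>k. fact (\<alpha> k) :: real"] all by simp
  ultimately show ?thesis
    by (simp add: taylor_coeff_def)
qed

text \<open>No derivative is taken in the directions \<open>k\<close> with \<open>\<alpha> k = 0\<close>. This is what later makes it unnecessary to
  expand logarithms: they occur only in rows that are trivial on the face.\<close>

lemma taylor_coeff_cong_on_face:
  assumes "\<forall>\<^sub>F u in nhds 0. (\<forall>k. \<alpha> k = 0 \<longrightarrow> u $ k = 0) \<longrightarrow> F u = H u"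
  shows "taylor_coeff ks \<alpha> F = taylor_coeff ks \<alpha> H"
proof -
  let ?Z = "{k. \<alpha> k = 0}"
  let ?eq = "\<lambda>F H. \<forall>\<^sub>F u in nhds 0. (\<forall>k\<in>?Z. u $ k = 0) \<longrightarrow> F u = H u"
  have pow: "?eq ((partial_deriv k ^^ n) F) ((partial_deriv k ^^ n) H)" if "?eq F H" "k \<notin> ?Z" for k n and F H :: "real^'k \<Rightarrow> real"
  proof (induction n)
    case (Suc n)
    from partial_deriv_cong_on_face[OF this that(2)] show ?case by simp
  qed (use that in simp)
  have step: "?eq ((partial_deriv k ^^ \<alpha> k) F) ((partial_deriv k ^^ \<alpha> k) H)" if "?eq F H" for k and F H :: "real^'k \<Rightarrow> real"
  proof (cases "\<alpha> k = 0")
    case False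
    then show ?thesis using pow[OF that, of k] by simp
  qed (use that in simp)
  have "?eq (foldr (\<lambda>k. partial_deriv k ^^ \<alpha> k) js F) (foldr (\<lambda>k. partial_deriv k ^^ \<alpha> k) js H)" for js
  proof (induction js)
    case (Cons k js)
    from step[OF this] show ?case by simp
  qed (use assms in simp)
  from eventually_nhds_x_imp_x[OF this[of ks]] show ?thesis
    by (simp add: taylor_coeff_def)
qed

lemma taylor_coeff_0: "taylor_coeff ks (\<lambda>_. 0) F = F 0"
proof -
  have "foldr (\<lambda>k. partial_deriv k ^^ 0) js F = F" for js
    by (induction js) auto
  then show ?thesis
    by (simp add: taylor_coeff_def)
qed

end

lemma sum_deg_Suc:
  fixes T :: "('k::finite \<Rightarrow> nat) \<Rightarrow> real"
  assumes "\<And>x. x k = 0 \<Longrightarrow> T x = 0"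
  shows "(\<Sum>x | deg x = Suc n. T x) = (\<Sum>y | deg y = n. T (y(k := Suc (y k))))"
proof -
  let ?s = "\<lambda>y. y(k := Suc (y k)) :: 'k \<Rightarrow> nat"
  have image: "?s ` {y. deg y = n} = {x. deg x = Suc n} - {x. x k = 0}"
  proof (intro equalityI subsetI)
    fix x assume x: "x \<in> {x. deg x = Suc n} - {x. x k = 0}"
    then have "?s (x(k := x k - 1)) = x"
      using exponent_Suc_pred[of x k] by simp
    moreover from this have "deg (x(k := x k - 1)) = n"
      using x deg_Suc[of "x(k := x k - 1)" k] by simp
    ultimately show "x \<in> ?s ` {y. deg y = n}"
      by (intro image_eqI[of _ _ "x(k := x k - 1)"]) simp_all
  qed (auto simp: deg_Suc)
  have "(\<Sum>x | deg x = Suc n. T x) = (\<Sum>x\<in>?s ` {y. deg y = n}. T x)"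
    unfolding image by (rule sum.mono_neutral_right) (auto simp: finite_deg_eq assms)
  also have "\<dots> = (\<Sum>y | deg y = n. T (?s y))"
    by (subst sum.reindex) (auto intro: inj_on_subset[OF inj_exponent_Suc])
  finally show ?thesis .
qed

section \<open>Multivariate Lagrange inversion in Good's form\<close>

text \<open>The factor \<open>g\<^sup>x |I - \<Gamma>|\<close> in Good's formula.\<close>

definition lagrange_weight ::
  "('k::finite \<Rightarrow> real^'k \<Rightarrow> real) \<Rightarrow> ('k \<Rightarrow> nat) \<Rightarrow> real^'k \<Rightarrow> real" where
  "lagrange_weight g x u = (\<Prod>k\<in>UNIV. g k u ^ x k) *
     det (mat 1 - (\<chi> k l. u $ k * partial_deriv l (\<lambda>v. ln (g k v)) u))"

text \<open>For \<open>x k > 0\<close>, row \<open>k\<close> is that of \<open>I - \<Gamma>\<close> multiplied by the \<open>x k\<close>-th power of \<open>g k\<close>, with the logarithmic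
  derivative absorbed into the power: \<open>h \<partial> (ln g) = \<partial> h / x\<close> for \<open>h = g\<^sup>x\<close>. If \<open>x k = 0\<close>, the derivative of the
  constant \<open>1\<close> vanishes (and so does the quotient, by \<open>0 / 0 = 0\<close>), so that row \<open>k\<close> is a row of the identity.\<close>

definition weight_matrix ::
  "('k::finite \<Rightarrow> real^'k \<Rightarrow> real) \<Rightarrow> ('k \<Rightarrow> nat) \<Rightarrow> real^'k \<Rightarrow> real^'k^'k" where
  "weight_matrix g x u = (\<chi> k l. (if k = l then g k u ^ x k else 0)
     - u $ k * (partial_deriv l (\<lambda>v. g k v ^ x k) u / real (x k)))"

text \<open>For nonzero \<open>w k\<close> this is conjugation by a diagonal matrix. The Leibniz expansion gives it for all \<open>w\<close>,
  because a permutation maps the set of points that it moves onto itself, so the factors \<open>w k\<close> and \<open>w (p k)\<close> have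
  the same product there.\<close>

lemma det_row_factor_to_column:
  fixes h w :: "'k::finite \<Rightarrow> real" and b :: "'k \<Rightarrow> 'k \<Rightarrow> real"
  shows "det (\<chi> k l. (if k = l then h k else 0) - w k * b k l)
       = det (\<chi> k l. (if k = l then h k else 0) - w l * b k l)"
  unfolding det_def
proof (intro sum.cong refl arg_cong2[where f = "(*)"])
  fix p :: "'k \<Rightarrow> 'k" assume "p \<in> {p. p permutes UNIV}"
  then have inj: "inj p" and surj: "surj p"
    by (auto simp: permutes_inj permutes_surj)
  let ?S = "{k. p k \<noteq> k}"
  have split: "(\<Prod>k\<in>UNIV. f k) = (\<Prod>k\<in>?S. f k) * (\<Prod>k\<in>-?S. f k)" for f :: "'k \<Rightarrow> real"
    using prod.union_disjoint[of ?S "-?S" f] by simp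
  have "bij_betw p ?S ?S"
  proof (rule bij_betw_imageI)
    show "inj_on p ?S"
      using inj by (rule inj_on_subset) simp
    have "k \<in> p ` ?S" if "p k \<noteq> k" for k
    proof -
      obtain j where "k = p j" using surj by (auto simp: surj_def)
      then show ?thesis using that by auto
    qed
    then show "p ` ?S = ?S"
      using inj by (auto dest: injD)
  qed
  then have "(\<Prod>k\<in>?S. w k) = (\<Prod>k\<in>?S. w (p k))"
    by (simp add: prod.reindex_bij_betw)
  then have "(\<Prod>k\<in>?S. (if k = p k then h k else 0) - w k * b k (p k))
    = (\<Prod>k\<in>?S. (if k = p k then h k else 0) - w (p k) * b k (p k))"
    using prod.distrib[of w "\<lambda>k. - b k (p k)" ?S] prod.distrib[of "\<lambda>k. w (p k)" "\<lambda>k. - b k (p k)" ?S]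
    by (simp add: eq_commute[of _ "p _"])
  moreover have "(\<Prod>k\<in>-?S. (if k = p k then h k else 0) - w k * b k (p k))
    = (\<Prod>k\<in>-?S. (if k = p k then h k else 0) - w (p k) * b k (p k))"
    by (rule prod.cong) auto
  ultimately show "(\<Prod>k\<in>UNIV. (\<chi> k l. (if k = l then h k else 0) - w k * b k l) $ k $ p k)
    = (\<Prod>k\<in>UNIV. (\<chi> k l. (if k = l then h k else 0) - w l * b k l) $ k $ p k)"
    by (simp add: split)
qed

lemma det_zero_if_left_null:
  fixes A :: "real^'k::finite^'k"
  assumes "\<And>l. (\<Sum>k\<in>UNIV. y k * A $ k $ l) = 0" "y k0 \<noteq> 0"
  shows "det A = 0"
proof (rule ccontr)
  assume "det A \<noteq> 0"
  then have "invertible (transpose A)"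
    by (simp add: invertible_det_nz det_transpose)
  moreover have "transpose A *v (\<chi> k. y k) = 0"
    using assms(1) by (simp add: vec_eq_iff matrix_vector_mult_def transpose_def mult.commute)
  ultimately have "(\<chi> k. y k) = 0"
    by (metis invertible_def matrix_left_invertible_ker)
  then show False
    using assms(2) by (auto simp: vec_eq_iff)
qed

lemma partial_deriv_power:
  assumes "((\<lambda>t. F (u + t *\<^sub>R axis k 1)) has_field_derivative D) (at 0)"
  shows "partial_deriv k (\<lambda>v. F v ^ n) u = real n * F u ^ (n - 1) * D"
  unfolding partial_deriv_def using assms
  by (intro DERIV_imp_deriv) (auto intro!: derivative_eq_intros)

lemma partial_deriv_ln:
  assumes "((\<lambda>t. F (u + t *\<^sub>R axis k 1)) has_field_derivative D) (at 0)" "F u > 0"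
  shows "partial_deriv k (\<lambda>v. ln (F v)) u = D / F u"
  unfolding partial_deriv_def using assms
  by (intro DERIV_imp_deriv) (auto intro!: derivative_eq_intros)

locale lagrange_system = coordinate_list ks for ks :: "'k::finite list" +
  fixes g :: "'k \<Rightarrow> real^'k \<Rightarrow> real"
  assumes g_expands: "\<And>k. \<exists>c. expands c (g k)"
    and g_pos: "\<And>k. g k 0 > 0"
begin

text \<open>In the rows with \<open>x k > 0\<close> the two matrices agree by the chain rule; in the other rows the factor \<open>u $ k\<close>
  is zero on the face.\<close>

lemma lagrange_weight_on_face:
  "\<forall>\<^sub>F u in nhds 0. (\<forall>k. x k = 0 \<longrightarrow> u $ k = 0) \<longrightarrow> lagrange_weight g x u = det (weight_matrix g x u)"
proof -
  have "\<forall>\<^sub>F u in nhds 0. g k u > 0" for k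
    using g_expands[of k] g_pos[of k] by (auto intro: order_tendstoD expands_continuous_at_0)
  moreover have "\<forall>\<^sub>F u in nhds 0. ((\<lambda>t. g k (u + t *\<^sub>R axis l 1)) has_field_derivative partial_deriv l (g k) u) (at 0)" for k l
    using g_expands[of k] expands_DERIV by blast
  ultimately have "\<forall>\<^sub>F u in nhds 0. (\<forall>k. g k u > 0) \<and>
      (\<forall>k l. ((\<lambda>t. g k (u + t *\<^sub>R axis l 1)) has_field_derivative partial_deriv l (g k) u) (at 0))"
    by (intro eventually_conj eventually_all_finite) auto
  then show ?thesis
  proof eventually_elim
    case (elim u)
    show ?case
    proof
      assume face: "\<forall>k. x k = 0 \<longrightarrow> u $ k = 0"
      have "lagrange_weight g x u
        = det (\<chi> k. g k u ^ x k *s (mat 1 - (\<chi> k l. u $ k * partial_deriv l (\<lambda>v. ln (g k v)) u)) $ k)"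
        unfolding lagrange_weight_def
        by (subst det_rows_mul) (simp add: vec_lambda_eta)
      also have "(\<chi> k. g k u ^ x k *s (mat 1 - (\<chi> k l. u $ k * partial_deriv l (\<lambda>v. ln (g k v)) u)) $ k)
        = weight_matrix g x u"
      proof -
        have "g k u ^ x k * ((if k = l then 1 else 0) - u $ k * partial_deriv l (\<lambda>v. ln (g k v)) u)
          = (if k = l then g k u ^ x k else 0) - u $ k * (partial_deriv l (\<lambda>v. g k v ^ x k) u / real (x k))" for k l
        proof (cases "x k")
          case 0
          then show ?thesis using face by auto
        next
          case (Suc m)
          have "partial_deriv l (\<lambda>v. ln (g k v)) u = partial_deriv l (g k) u / g k u"
            using elim by (intro partial_deriv_ln) auto
          moreover have "partial_deriv l (\<lambda>v. g k v ^ x k) u = real (x k) * g k u ^ (x k - 1) * partial_deriv l (g k) u"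
            using elim by (intro partial_deriv_power) auto
          moreover have "g k u > 0" using elim by simp
          moreover have "g k u ^ x k = g k u * g k u ^ (x k - 1)" "real (x k) \<noteq> 0"
            by (simp_all add: Suc)
          ultimately show ?thesis
            by (auto simp: field_simps)
        qed
        then show ?thesis
          by (simp only: vec_eq_iff weight_matrix_def mat_def vec_lambda_beta vector_minus_component
              vector_smult_component simp_thms)
      qed
      finally show "lagrange_weight g x u = det (weight_matrix g x u)" .
    qed
  qed
qed

text \<open>The vanishing of the coefficient at \<open>x\<close> itself is the heart of Good's formula. Once the row factors \<open>u $ k\<close> have become
  column factors, the differential operator in the entry \<open>(k, l)\<close> is the Euler operator \<open>u\<^sub>l \<partial>\<^sub>l\<close>, which multiplies the
  coefficient at \<open>\<alpha>\<close> by \<open>\<alpha> l\<close>. Hence the coefficient of the determinant is a sum, over families \<open>a\<close> of exponents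
  with sum \<open>x\<close>, of multiples of the numerical determinants of \<open>\<delta>\<^sub>k\<^sub>l - a k l / x k\<close>, and \<open>x\<close> is a left null vector.\<close>

lemma weight_matrix_expands:
  "\<exists>c. expands c (\<lambda>u. det (weight_matrix g x u)) \<and> (x \<noteq> (\<lambda>_. 0) \<longrightarrow> c x = 0)"
proof -
  \<comment> \<open>The second part matters because division by \<open>x k\<close> is meaningless in the rows with \<open>x k = 0\<close>; the families that
    survive use the constant monomial there.\<close>
  have "\<exists>c. expands c (\<lambda>u. g k u ^ x k) \<and> (x k = 0 \<longrightarrow> (\<forall>\<alpha>. \<alpha> \<noteq> (\<lambda>_. 0) \<longrightarrow> c \<alpha> = 0))" for k
  proof (cases "x k = 0")
    case True
    then show ?thesis using expands_const[of 1]
      by (intro exI[of _ "\<lambda>\<alpha>. if \<alpha> = (\<lambda>_. 0) then 1 else 0"]) auto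
  next
    case False
    then show ?thesis using g_expands[of k] expands_power[of _ "g k" "x k"] by auto
  qed
  then obtain c where c: "\<And>k. expands (c k) (\<lambda>u. g k u ^ x k)"
    and c0: "\<And>k \<alpha>. x k = 0 \<Longrightarrow> \<alpha> \<noteq> (\<lambda>_. 0) \<Longrightarrow> c k \<alpha> = 0"
    by metis
  define E where "E k l u = (if k = l then g k u ^ x k else 0)
     - u $ l * (partial_deriv l (\<lambda>v. g k v ^ x k) u / real (x k))" for k l u
  define D where "D k l \<alpha> = c k \<alpha> * ((if k = l then 1 else 0) - real (\<alpha> l) / real (x k))" for k l \<alpha>
  have E: "expands (D k l) (E k l)" for k l
  proof -
    have "expands (\<lambda>\<alpha>. (if k = l then 1 else 0) * c k \<alpha>) (\<lambda>u. (if k = l then 1 else 0) * g k u ^ x k)"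
      by (rule expands_cmult[OF c])
    moreover have "expands (\<lambda>\<alpha>. 1 / real (x k) * (if \<alpha> l = 0 then 0 else coeff_deriv l (c k) (\<alpha>(l := \<alpha> l - 1))))
        (\<lambda>u. 1 / real (x k) * (u $ l * partial_deriv l (\<lambda>v. g k v ^ x k) u))"
      by (rule expands_cmult[OF expands_coord_mult[OF expands_partial_deriv[OF c]]])
    ultimately have "expands (\<lambda>\<alpha>. (if k = l then 1 else 0) * c k \<alpha>
        - 1 / real (x k) * (if \<alpha> l = 0 then 0 else coeff_deriv l (c k) (\<alpha>(l := \<alpha> l - 1))))
      (\<lambda>u. (if k = l then 1 else 0) * g k u ^ x k
        - 1 / real (x k) * (u $ l * partial_deriv l (\<lambda>v. g k v ^ x k) u))"
      by (rule expands_diff)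
    moreover have "(\<lambda>\<alpha>. (if k = l then 1 else 0) * c k \<alpha>
        - 1 / real (x k) * (if \<alpha> l = 0 then 0 else coeff_deriv l (c k) (\<alpha>(l := \<alpha> l - 1)))) = D k l"
    proof
      fix \<alpha>
      have "(if \<alpha> l = 0 then 0 else coeff_deriv l (c k) (\<alpha>(l := \<alpha> l - 1))) = real (\<alpha> l) * c k \<alpha>"
        by (cases "\<alpha> l = 0") (simp_all add: coeff_deriv_def fun_upd_idem)
      then show "(if k = l then 1 else 0) * c k \<alpha>
        - 1 / real (x k) * (if \<alpha> l = 0 then 0 else coeff_deriv l (c k) (\<alpha>(l := \<alpha> l - 1))) = D k l \<alpha>"
        by (simp add: D_def algebra_simps)
    qed
    moreover have "(\<lambda>u. (if k = l then 1 else 0) * g k u ^ x k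
        - 1 / real (x k) * (u $ l * partial_deriv l (\<lambda>v. g k v ^ x k) u)) = E k l"
      by (auto simp: E_def fun_eq_iff)
    ultimately show ?thesis
      by simp
  qed
  have det_E: "det (weight_matrix g x u) = (\<Sum>p | p permutes UNIV. of_int (sign p) * (\<Prod>k\<in>UNIV. E k (p k) u))" for u
    unfolding weight_matrix_def
    by (subst det_row_factor_to_column) (simp add: det_def E_def)
  let ?fam = "\<lambda>\<alpha>. {a :: 'k \<Rightarrow> 'k \<Rightarrow> nat. (\<lambda>l. \<Sum>k\<in>UNIV. a k l) = \<alpha>}"
  define d where "d \<alpha> = (\<Sum>p | p permutes (UNIV::'k set). of_int (sign p) * (\<Sum>a\<in>?fam \<alpha>. \<Prod>k\<in>UNIV. D k (p k) (a k)))" for \<alpha>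
  have "expands d (\<lambda>u. det (weight_matrix g x u))"
    unfolding det_E d_def by (intro expands_sum expands_cmult expands_prod E)
  moreover have "d x = 0" if x: "x \<noteq> (\<lambda>_. 0)"
  proof -
    have "d x = (\<Sum>a\<in>?fam x. \<Sum>p | p permutes (UNIV::'k set). of_int (sign p) * (\<Prod>k\<in>UNIV. D k (p k) (a k)))"
      unfolding d_def sum_distrib_left by (rule sum.swap)
    also have "\<dots> = (\<Sum>a\<in>?fam x. det (\<chi> k l. D k l (a k)))"
      by (simp add: det_def)
    also have "\<dots> = 0"
    proof (intro sum.neutral ballI)
      fix a assume a: "a \<in> ?fam x"
      let ?N = "\<chi> k l. (if k = l then 1 else 0) - real (a k l) / real (x k) :: real^'k^'k"
      have "det (\<chi> k l. D k l (a k)) = det (\<chi> k. c k (a k) *s ?N $ k)"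
        by (rule arg_cong[where f = det]) (simp add: vec_eq_iff D_def)
      also have "\<dots> = (\<Prod>k\<in>UNIV. c k (a k)) * det ?N"
        by (subst det_rows_mul) (simp add: vec_lambda_eta)
      also have "\<dots> = 0"
      proof (cases "\<exists>k. x k = 0 \<and> a k \<noteq> (\<lambda>_. 0)")
        case True
        then have "(\<Prod>k\<in>UNIV. c k (a k)) = 0"
          using c0 by auto
        then show ?thesis by simp
      next
        case False
        have "(\<Sum>k\<in>UNIV. real (x k) * ?N $ k $ l) = 0" for l
        proof -
          have "real (x k) * ?N $ k $ l = (if k = l then real (x l) else 0) - real (a k l)" for k
          proof (cases "x k = 0")
            case True
            then have "a k = (\<lambda>_. 0)" using False True by blast
            then show ?thesis using True by auto
          qed (simp add: right_diff_distrib)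
          then have "(\<Sum>k\<in>UNIV. real (x k) * ?N $ k $ l) = real (x l) - real (\<Sum>k\<in>UNIV. a k l)"
            by (simp add: sum_subtractf)
          also have "(\<Sum>k\<in>UNIV. a k l) = x l"
            using a by (auto simp: fun_eq_iff)
          finally show ?thesis by simp
        qed
        moreover obtain k where "real (x k) \<noteq> 0"
          using x by (auto simp: fun_eq_iff)
        ultimately have "det ?N = 0"
          by (rule det_zero_if_left_null)
        then show ?thesis by simp
      qed
      finally show "det (\<chi> k l. D k l (a k)) = 0" .
    qed
    finally show ?thesis .
  qed
  ultimately show ?thesis
    by blast
qed

text \<open>The coefficient of \<open>v\<^sup>n\<close> in \<open>f(u(v))\<close> for the solution \<open>u(v)\<close> of \<open>u\<^sub>k = v g\<^sub>k(u)\<close>, according to Good's formula;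
  the solution itself does not occur below.\<close>

definition lagrange_coeff :: "nat \<Rightarrow> (real^'k \<Rightarrow> real) \<Rightarrow> real" where
  "lagrange_coeff n f = (\<Sum>x | deg x = n. taylor_coeff ks x (\<lambda>u. f u * lagrange_weight g x u))"

lemma taylor_coeff_weight:
  "taylor_coeff ks x (\<lambda>u. f u * lagrange_weight g x u)
   = taylor_coeff ks x (\<lambda>u. f u * det (weight_matrix g x u))"
  using lagrange_weight_on_face[of x]
  by (intro taylor_coeff_cong_on_face) (auto elim: eventually_mono)

lemma weight_mult_expands:
  assumes "expands c f"
  shows "\<exists>d. expands d (\<lambda>u. f u * det (weight_matrix g x u))"
  using weight_matrix_expands expands_mult[OF assms] by blast

lemma lagrange_coeff_0: "lagrange_coeff 0 f = f 0"
proof -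
  have "lagrange_weight g (\<lambda>_. 0) 0 = 1"
    by (simp add: lagrange_weight_def mat_def det_I[unfolded mat_def] flip: zero_vec_def)
  then show ?thesis
    by (simp add: lagrange_coeff_def taylor_coeff_0)
qed

lemma lagrange_coeff_const: "lagrange_coeff (Suc n) (\<lambda>_. 1) = 0"
  unfolding lagrange_coeff_def
proof (intro sum.neutral ballI)
  fix x :: "'k \<Rightarrow> nat" assume "x \<in> {x. deg x = Suc n}"
  then have "x \<noteq> (\<lambda>_. 0)"
    using deg_eq_0_iff[of x] by (auto simp del: deg_eq_0_iff)
  then show "taylor_coeff ks x (\<lambda>u. 1 * lagrange_weight g x u) = 0"
    using weight_matrix_expands[of x] taylor_coeff_expands taylor_coeff_weight[of x "\<lambda>_. 1"] by auto
qed

lemma lagrange_coeff_sum: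
  assumes "\<And>i. i \<in> I \<Longrightarrow> \<exists>c. expands c (f i)"
  shows "lagrange_coeff n (\<lambda>u. \<Sum>i\<in>I. f i u) = (\<Sum>i\<in>I. lagrange_coeff n (f i))"
proof -
  have "taylor_coeff ks x (\<lambda>u. (\<Sum>i\<in>I. f i u) * lagrange_weight g x u)
    = (\<Sum>i\<in>I. taylor_coeff ks x (\<lambda>u. f i u * lagrange_weight g x u))" for x
  proof -
    have "\<forall>i\<in>I. \<exists>d. expands d (\<lambda>u. f i u * det (weight_matrix g x u))"
      using assms weight_mult_expands by blast
    then obtain d where d: "\<And>i. i \<in> I \<Longrightarrow> expands (d i) (\<lambda>u. f i u * det (weight_matrix g x u))"
      by metis
    have "expands (\<lambda>\<alpha>. \<Sum>i\<in>I. d i \<alpha>) (\<lambda>u. (\<Sum>i\<in>I. f i u) * det (weight_matrix g x u))"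
      unfolding sum_distrib_right by (rule expands_sum[OF d])
    from taylor_coeff_expands[OF this] show ?thesis
      by (simp add: taylor_coeff_weight taylor_coeff_expands[OF d])
  qed
  then show ?thesis
    unfolding lagrange_coeff_def by (simp add: sum.swap[of _ _ I])
qed

lemma lagrange_coeff_cmult:
  assumes "expands c f"
  shows "lagrange_coeff n (\<lambda>u. a * f u) = a * lagrange_coeff n f"
proof -
  have "taylor_coeff ks x (\<lambda>u. (a * f u) * lagrange_weight g x u)
    = a * taylor_coeff ks x (\<lambda>u. f u * lagrange_weight g x u)" for x
  proof -
    obtain d where d: "expands d (\<lambda>u. f u * det (weight_matrix g x u))"
      using weight_mult_expands[OF assms] by blast
    from expands_cmult[OF this, of a]
    have "expands (\<lambda>\<alpha>. a * d \<alpha>) (\<lambda>u. (a * f u) * det (weight_matrix g x u))"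
      by (simp add: mult.assoc)
    with d show ?thesis
      by (simp add: taylor_coeff_weight taylor_coeff_expands)
  qed
  then show ?thesis
    unfolding lagrange_coeff_def by (simp add: sum_distrib_left)
qed

text \<open>Neither the factor \<open>h\<close> nor the weight can lower the order of vanishing at \<open>0\<close>.\<close>

lemma lagrange_coeff_high_order:
  assumes "expands c f" "\<And>\<alpha>. deg \<alpha> \<le> n \<Longrightarrow> c \<alpha> = 0" "expands b h"
  shows "lagrange_coeff n (\<lambda>u. f u * h u) = 0"
  unfolding lagrange_coeff_def
proof (intro sum.neutral ballI)
  fix x :: "'k \<Rightarrow> nat" assume x: "x \<in> {x. deg x = n}"
  obtain d where d: "expands d (\<lambda>u. h u * det (weight_matrix g x u))"
    using weight_mult_expands[OF assms(3)] by blast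
  have "taylor_coeff ks x (\<lambda>u. f u * h u * lagrange_weight g x u)
    = (\<Sum>a | (\<lambda>k. a True k + a False k) = x. c (a True) * d (a False))"
    using taylor_coeff_expands[OF expands_mult[OF assms(1) d]]
    unfolding taylor_coeff_weight by (simp add: mult.assoc)
  also have "\<dots> = 0"
  proof (intro sum.neutral ballI)
    fix a :: "bool \<Rightarrow> 'k \<Rightarrow> nat" assume "a \<in> {a. (\<lambda>k. a True k + a False k) = x}"
    then have "deg (a True) \<le> deg x"
      by (intro deg_mono) auto
    then show "c (a True) * d (a False) = 0"
      using assms(2) x by simp
  qed
  finally show "taylor_coeff ks x (\<lambda>u. f u * h u * lagrange_weight g x u) = 0" .
qed

text \<open>Extracting the coefficient at \<open>x\<close> from a multiple of \<open>u $ k\<close> means extracting it at \<open>y\<close>, where \<open>x\<close> is \<open>y\<close> with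
  the exponent of \<open>k\<close> raised by one, and the weight for \<open>x\<close> is \<open>g k\<close> times the weight for \<open>y\<close>. An expansion replaces
  the weight for \<open>x\<close> only on the face of \<open>x\<close>; that is compatible with coefficients at \<open>y\<close> because the
  face of \<open>y\<close> is contained in it.\<close>

lemma lagrange_coeff_coord_mult:
  assumes f: "expands c f"
  shows "lagrange_coeff (Suc n) (\<lambda>u. u $ k * f u) = lagrange_coeff n (\<lambda>u. g k u * f u)"
proof -
  let ?T = "\<lambda>x. taylor_coeff ks x (\<lambda>u. u $ k * f u * lagrange_weight g x u)"
  let ?s = "\<lambda>y. y(k := Suc (y k)) :: 'k \<Rightarrow> nat"
  have T: "?T x = (if x k = 0 then 0 else d (x(k := x k - 1)))"
    if "expands d (\<lambda>u. f u * det (weight_matrix g x u))" for x d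
    using taylor_coeff_expands[OF expands_coord_mult[OF that, of k], of x]
    unfolding taylor_coeff_weight by (simp add: mult.assoc)
  have T0: "?T x = 0" if "x k = 0" for x
    using weight_mult_expands[OF f, of x] T that by auto
  have TSuc: "?T (?s y) = taylor_coeff ks y (\<lambda>u. g k u * f u * lagrange_weight g y u)" for y
  proof -
    obtain d where d: "expands d (\<lambda>u. f u * det (weight_matrix g (?s y) u))"
      using weight_mult_expands[OF f] by blast
    have "?T (?s y) = d y"
      using T[OF d] by simp
    also have "\<dots> = taylor_coeff ks y (\<lambda>u. f u * det (weight_matrix g (?s y) u))"
      using taylor_coeff_expands[OF d] by simp
    also have "\<dots> = taylor_coeff ks y (\<lambda>u. f u * lagrange_weight g (?s y) u)"
    proof (rule taylor_coeff_cong_on_face)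
      show "\<forall>\<^sub>F u in nhds 0. (\<forall>j. y j = 0 \<longrightarrow> u $ j = 0) \<longrightarrow>
          f u * det (weight_matrix g (?s y) u) = f u * lagrange_weight g (?s y) u"
        using lagrange_weight_on_face[of "?s y"] by eventually_elim auto
    qed
    also have "(\<lambda>u. f u * lagrange_weight g (?s y) u) = (\<lambda>u. g k u * f u * lagrange_weight g y u)"
    proof
      fix u
      have "(\<Prod>j\<in>UNIV. g j u ^ ?s y j) = g k u * (\<Prod>j\<in>UNIV. g j u ^ y j)"
        by (subst (1 2) prod.remove[of UNIV k]) (auto intro!: prod.cong)
      then show "f u * lagrange_weight g (?s y) u = g k u * f u * lagrange_weight g y u"
        by (simp add: lagrange_weight_def)
    qed
    finally show ?thesis .
  qed
  have "lagrange_coeff (Suc n) (\<lambda>u. u $ k * f u) = (\<Sum>x | deg x = Suc n. ?T x)"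
    by (simp add: lagrange_coeff_def)
  also have "\<dots> = (\<Sum>y | deg y = n. ?T (?s y))"
    by (rule sum_deg_Suc) (rule T0)
  finally show ?thesis
    by (simp only: TSuc lagrange_coeff_def)
qed

end

section \<open>The matrix case\<close>

definition unflatten :: "real^('n \<times> 'n) \<Rightarrow> 'n::finite sqmat" where
  "unflatten u = (\<chi> i j. u $ (i, j))"

lemma unflatten_nth [simp]: "unflatten u $ i $ j = u $ (i, j)"
  by (simp add: unflatten_def)

lemma mpow_add: "mpow G (m + n) = mpow G m ** mpow G n"
  by (induction m) (simp_all add: matrix_mul_assoc)

subsection \<open>Power series of matrix functions\<close>

text \<open>The number of walks with \<open>m\<close> steps from \<open>i\<close> to \<open>j\<close> that use each directed edge \<open>p\<close> exactly \<open>\<alpha> p\<close> times. It is the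
  coefficient of the monomial with exponent \<open>\<alpha>\<close> in the entry \<open>(i, j)\<close> of the \<open>m\<close>-th power of a matrix of variables.\<close>

primrec walk_count :: "nat \<Rightarrow> 'n::finite \<Rightarrow> 'n \<Rightarrow> ('n \<times> 'n \<Rightarrow> nat) \<Rightarrow> real" where
  "walk_count 0 i j \<alpha> = (if i = j \<and> \<alpha> = (\<lambda>_. 0) then 1 else 0)"
| "walk_count (Suc m) i j \<alpha> =
     (\<Sum>k\<in>UNIV. if \<alpha> (i, k) = 0 then 0 else walk_count m k j (\<alpha>((i, k) := \<alpha> (i, k) - 1)))"

lemma walk_count_nonneg: "walk_count m i j \<alpha> \<ge> 0"
  by (induction m arbitrary: i \<alpha>) (auto intro!: sum_nonneg)

lemma walk_count_eq_0: "deg \<alpha> \<noteq> m \<Longrightarrow> walk_count m i j \<alpha> = 0"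
proof (induction m arbitrary: i \<alpha>)
  case (Suc m)
  have "walk_count m k j (\<alpha>((i, k) := \<alpha> (i, k) - 1)) = 0" if "\<alpha> (i, k) \<noteq> 0" for k
  proof (rule Suc.IH)
    show "deg (\<alpha>((i, k) := \<alpha> (i, k) - 1)) \<noteq> m"
      using Suc.prems deg_Suc[of "\<alpha>((i, k) := \<alpha> (i, k) - 1)" "(i, k)"]
      unfolding exponent_Suc_pred[of \<alpha> "(i, k)", OF that] by simp
  qed
  then show ?case
    by (auto intro!: sum.neutral)
qed auto

lemma mpow_eq_sum_walks:
  "mpow (unflatten u) m $ i $ j = (\<Sum>\<alpha> | deg \<alpha> = m. walk_count m i j \<alpha> * monom_at u \<alpha>)"
proof (induction m arbitrary: i)
  case 0
  have "{\<alpha>. deg \<alpha> = 0} = {\<lambda>_::'a \<times> 'a. 0}"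
    by auto
  then show ?case
    by (simp add: mat_def)
next
  case (Suc m)
  let ?pred = "\<lambda>\<alpha> k. \<alpha>((i, k) := \<alpha> (i, k) - 1)"
  have "u $ (i, k) * mpow (unflatten u) m $ k $ j = (\<Sum>\<alpha> | deg \<alpha> = Suc m.
      (if \<alpha> (i, k) = 0 then 0 else walk_count m k j (?pred \<alpha> k)) * monom_at u \<alpha>)" for k
    by (subst sum_deg_Suc[where k = "(i, k)"])
       (simp_all add: Suc.IH monom_at_Suc sum_distrib_left ac_simps del: fun_upd_apply add: fun_upd_same)
  then show ?case
    by (simp add: matrix_matrix_mult_def sum_distrib_right sum.swap[of _ UNIV])
qed

lemma expands_mpow: "expands (walk_count m i j) (\<lambda>u. mpow (unflatten u) m $ i $ j)"
proof (rule expandsI[of 1])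
  have fin: "finite {\<alpha> :: 'a \<times> 'a \<Rightarrow> nat. deg \<alpha> = m}"
    by (rule finite_deg_eq)
  have "(\<lambda>\<alpha>. norm (walk_count m i j \<alpha> * 1 ^ deg \<alpha>)) summable_on UNIV"
    by (rule has_sum_imp_summable[OF has_sum_finite_neutralI[OF fin]]) (auto intro: walk_count_eq_0)
  moreover have "((\<lambda>\<alpha>. walk_count m i j \<alpha> * monom_at u \<alpha>) has_sum mpow (unflatten u) m $ i $ j) UNIV" for u
    by (rule has_sum_finite_neutralI[OF fin]) (auto simp: mpow_eq_sum_walks intro: walk_count_eq_0)
  ultimately show "expands_on 1 (walk_count m i j) (\<lambda>u. mpow (unflatten u) m $ i $ j)"
    by (simp add: expands_on_def)
qed simp

lemma mpow_const_le:
  assumes "r \<ge> 0"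
  shows "mpow (unflatten (\<chi> p. r) :: 'n::finite sqmat) m $ i $ j \<le> (real CARD('n) * r) ^ m"
proof (induction m arbitrary: i)
  case (Suc m)
  have "mpow (unflatten (\<chi> p. r) :: 'n sqmat) (Suc m) $ i $ j
    = (\<Sum>k\<in>(UNIV::'n set). r * mpow (unflatten (\<chi> p. r)) m $ k $ j)"
    by (simp add: matrix_matrix_mult_def)
  also have "\<dots> \<le> (\<Sum>k\<in>(UNIV::'n set). r * (real CARD('n) * r) ^ m)"
    by (intro sum_mono mult_left_mono Suc.IH assms)
  finally show ?case by simp
qed (simp add: mat_def)

text \<open>Only the term with \<open>m = deg \<alpha>\<close> contributes to a monomial with exponent \<open>\<alpha>\<close>.\<close>

definition Lam_hat_coeff :: "(nat \<Rightarrow> 'n::finite sqmat) \<Rightarrow> 'n \<Rightarrow> 'n \<Rightarrow> ('n \<times> 'n \<Rightarrow> nat) \<Rightarrow> real" where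
  "Lam_hat_coeff Lam i j \<alpha> = (\<Sum>l\<in>UNIV. Lam (deg \<alpha>) $ i $ l * walk_count (deg \<alpha>) l j \<alpha>)"

lemma sums_matrix_componentwise:
  fixes A :: "nat \<Rightarrow> real^'n^'m"
  assumes "\<And>i j. (\<lambda>m. A m $ i $ j) sums B i j"
  shows "A sums (\<chi> i j. B i j)"
  using assms unfolding sums_def by (intro vec_tendstoI) simp

text \<open>At the corner with all entries \<open>1 / (2 N)\<close> the entries of the \<open>m\<close>-th matrix power are at most \<open>1 / 2\<^sup>m\<close>. All coefficients
  are nonnegative, so the series converges absolutely there, and summing over exponents by degree gives back
  the series over \<open>m\<close>.\<close>

lemma expands_lam_hat:
  fixes Lam :: "nat \<Rightarrow> 'n::finite sqmat"
  assumes nonneg: "\<And>m i j. Lam m $ i $ j \<ge> 0" and le1: "\<And>m i j. Lam m $ i $ j \<le> 1"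
  shows "expands (Lam_hat_coeff Lam i j) (\<lambda>u. lam_hat Lam i j (unflatten u))"
proof -
  define r where "r = 1 / (2 * real CARD('n))"
  have r: "r > 0" "real CARD('n) * r = 1 / 2"
    by (simp_all add: r_def)
  let ?S = "Sigma (UNIV::nat set) (\<lambda>m. {\<alpha> :: 'n \<times> 'n \<Rightarrow> nat. deg \<alpha> = m})"
  have bij: "bij_betw snd ?S UNIV"
    by (rule bij_betwI[where g = "\<lambda>\<alpha>. (deg \<alpha>, \<alpha>)"]) auto
  have degree_part: "(\<Sum>\<alpha> | deg \<alpha> = m. Lam_hat_coeff Lam i j \<alpha> * monom_at u \<alpha>)
      = (Lam m ** mpow (unflatten u) m) $ i $ j" for i j m u
  proof -
    have "(\<Sum>\<alpha> | deg \<alpha> = m. Lam_hat_coeff Lam i j \<alpha> * monom_at u \<alpha>)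
      = (\<Sum>\<alpha> | deg \<alpha> = m. \<Sum>l\<in>UNIV. Lam m $ i $ l * (walk_count m l j \<alpha> * monom_at u \<alpha>))"
      by (intro sum.cong) (auto simp: Lam_hat_coeff_def sum_distrib_right mult.assoc)
    also have "\<dots> = (\<Sum>l\<in>UNIV. Lam m $ i $ l * mpow (unflatten u) m $ l $ j)"
      by (subst sum.swap) (simp add: mpow_eq_sum_walks sum_distrib_left)
    finally show ?thesis
      by (simp add: matrix_matrix_mult_def)
  qed
  have coeff_nonneg: "Lam_hat_coeff Lam i j \<alpha> \<ge> 0" for i j \<alpha>
    by (auto simp: Lam_hat_coeff_def intro!: sum_nonneg mult_nonneg_nonneg nonneg walk_count_nonneg)
  have monom_r: "monom_at (\<chi> p. r) \<alpha> = r ^ deg \<alpha>" for \<alpha> :: "'n \<times> 'n \<Rightarrow> nat"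
    by (simp add: monom_at_def deg_def power_sum)
  have summable: "(\<lambda>\<alpha>. Lam_hat_coeff Lam i j \<alpha> * r ^ deg \<alpha>) abs_summable_on UNIV" for i j
  proof -
    have "(\<lambda>p. Lam_hat_coeff Lam i j (snd p) * r ^ deg (snd p)) summable_on ?S"
    proof (rule summable_on_SigmaI)
      show "((\<lambda>\<alpha>. Lam_hat_coeff Lam i j (snd (m, \<alpha>)) * r ^ deg (snd (m, \<alpha>))) has_sum
          (Lam m ** mpow (unflatten (\<chi> p. r)) m) $ i $ j) {\<alpha>. deg \<alpha> = m}" for m
        by (rule has_sum_finiteI) (auto simp: finite_deg_eq monom_r simp flip: degree_part intro!: sum.cong)
      have le: "(Lam m ** mpow (unflatten (\<chi> p. r)) m) $ i $ j \<le> real CARD('n) * (1 / 2) ^ m" for m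
      proof -
        have "(Lam m ** mpow (unflatten (\<chi> p. r)) m) $ i $ j
          \<le> (\<Sum>l\<in>(UNIV::'n set). 1 * (real CARD('n) * r) ^ m)"
          unfolding matrix_matrix_mult_def vec_lambda_beta
        proof (intro sum_mono mult_mono)
          show "mpow (unflatten (\<chi> p. r)) m $ l $ j \<le> (real CARD('n) * r) ^ m" for l :: 'n
            using r by (intro mpow_const_le) simp
          show "0 \<le> mpow (unflatten (\<chi> p. r)) m $ l $ j" for l
            using r by (auto simp: mpow_eq_sum_walks monom_r intro!: sum_nonneg mult_nonneg_nonneg walk_count_nonneg)
        qed (use le1 in auto)
        then show ?thesis
          by (simp add: r)
      qed
      have geometric: "(\<lambda>m. real CARD('n) * (1 / 2) ^ m) summable_on (UNIV :: nat set)"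
        by (intro summable_on_cmult_right norm_summable_imp_summable_on) (simp add: summable_geometric)
      have nonneg: "(Lam m ** mpow (unflatten (\<chi> p. r)) m) $ i $ j \<ge> 0" for m
        using r by (auto simp: monom_r coeff_nonneg intro!: sum_nonneg simp flip: degree_part)
      show "(\<lambda>m. (Lam m ** mpow (unflatten (\<chi> p. r)) m) $ i $ j) summable_on UNIV"
        by (rule summable_on_comparison_test[OF geometric le nonneg])
    qed (use r coeff_nonneg in auto)
    then have "(\<lambda>\<alpha>. Lam_hat_coeff Lam i j \<alpha> * r ^ deg \<alpha>) summable_on UNIV"
      by (subst (asm) summable_on_reindex_bij_betw[OF bij])
    then show ?thesis
      using r coeff_nonneg by (simp add: abs_mult)
  qed
  have sums: "((\<lambda>\<alpha>. Lam_hat_coeff Lam i j \<alpha> * monom_at u \<alpha>) has_sum lam_hat Lam i j (unflatten u)) UNIV"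
    if u: "\<And>p. \<bar>u $ p\<bar> \<le> r" for u i j
  proof -
    define s where "s i j = (\<Sum>\<^sub>\<infinity>\<alpha>. Lam_hat_coeff Lam i j \<alpha> * monom_at u \<alpha>)" for i j
    have s: "((\<lambda>\<alpha>. Lam_hat_coeff Lam i j \<alpha> * monom_at u \<alpha>) has_sum s i j) UNIV" for i j
    proof -
      have "(\<lambda>\<alpha>. Lam_hat_coeff Lam i j \<alpha> * monom_at u \<alpha>) abs_summable_on UNIV"
        using summable[of i j]
        by (rule Infinite_Sum.abs_summable_on_comparison_test)
           (use monom_at_bound[OF u] r in \<open>auto simp: abs_mult power_abs intro!: mult_left_mono\<close>)
      then show ?thesis
        unfolding s_def by (rule has_sum_infsum[OF abs_summable_summable])
    qed
    have "(\<lambda>m. (Lam m ** mpow (unflatten u) m) $ i $ j) sums s i j" for i j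
    proof (rule has_sum_imp_sums)
      have "((\<lambda>p. Lam_hat_coeff Lam i j (snd p) * monom_at u (snd p)) has_sum s i j) ?S"
        using s by (subst has_sum_reindex_bij_betw[OF bij])
      then show "((\<lambda>m. (Lam m ** mpow (unflatten u) m) $ i $ j) has_sum s i j) UNIV"
        by (rule has_sum_Sigma') (auto simp: finite_deg_eq degree_part intro!: has_sum_finiteI)
    qed
    then have "(\<lambda>m. Lam m ** mpow (unflatten u) m) sums (\<chi> i j. s i j)"
      by (rule sums_matrix_componentwise)
    then have "lam_hat Lam i j (unflatten u) = s i j"
      by (simp add: lam_hat_def Lam_hat_def sums_unique[symmetric])
    then show ?thesis
      using s by simp
  qed
  have "expands_on r (Lam_hat_coeff Lam i j) (\<lambda>u. lam_hat Lam i j (unflatten u))"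
    using summable sums by (auto simp: expands_on_def)
  then show ?thesis
    using r by (intro expandsI)
qed

subsection \<open>\<open>Q(n, a)\<close> as a Lagrange coefficient\<close>

definition Lam_hat_system :: "(nat \<Rightarrow> 'n::finite sqmat) \<Rightarrow> 'n \<times> 'n \<Rightarrow> real^('n \<times> 'n) \<Rightarrow> real" where
  "Lam_hat_system Lam p u = lam_hat Lam (fst p) (snd p) (unflatten u)"

definition entry_list :: "('n::{finite,linorder} \<times> 'n) list" where
  "entry_list = List.product (sorted_list_of_set UNIV) (sorted_list_of_set UNIV)"

lemma pderiv_entry_unflatten:
  "pderiv_entry i j F (unflatten u) = partial_deriv (i, j) (\<lambda>v. F (unflatten v)) u"
proof -
  have "unflatten (u + t *\<^sub>R axis (i, j) 1) = unflatten u + t *\<^sub>R axis i (axis j 1)" for t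
    by (simp add: vec_eq_iff axis_def)
  then show ?thesis
    by (simp add: pderiv_entry_def partial_deriv_def)
qed

lemma mixed_deriv_unflatten:
  "mixed_deriv (curry \<alpha>) F (unflatten u)
   = foldr (\<lambda>p. partial_deriv p ^^ \<alpha> p) entry_list (\<lambda>v. F (unflatten v)) u"
proof -
  let ?D = "\<lambda>p. case p of (i, j) \<Rightarrow> pderiv_entry i j ^^ \<alpha> p"
  have pow: "(\<lambda>v. (pderiv_entry i j ^^ n) F (unflatten v)) = (partial_deriv (i, j) ^^ n) (\<lambda>v. F (unflatten v))"
    for i j n and F :: "'a sqmat \<Rightarrow> real"
    by (induction n) (simp_all add: pderiv_entry_unflatten)
  have "(\<lambda>v. foldr (\<circ>) (map ?D ps) id F (unflatten v)) = foldr (\<lambda>p. partial_deriv p ^^ \<alpha> p) ps (\<lambda>v. F (unflatten v))" for ps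
    by (induction ps) (auto simp: pow split: prod.split)
  from fun_cong[OF this[of entry_list]] show ?thesis
    by (simp add: mixed_deriv_def entry_list_def product_concat_map map_concat o_def curry_def)
qed

lemma Gamma_mat_unflatten:
  "Gamma_mat Lam (unflatten u) = (\<chi> p q. u $ p * partial_deriv q (\<lambda>v. ln (Lam_hat_system Lam p v)) u)"
  by (simp add: Gamma_mat_def vec_eq_iff Lam_hat_system_def pderiv_entry_unflatten)

lemma entry_list_enumerates: "coordinate_list (entry_list :: ('n::{finite,linorder} \<times> 'n) list)"
  by standard (auto simp: entry_list_def distinct_product)

lemma bij_betw_curry_deg:
  "bij_betw curry {\<alpha>. deg \<alpha> = n} {x :: 'n::finite \<Rightarrow> 'n \<Rightarrow> nat. (\<Sum>i\<in>UNIV. \<Sum>j\<in>UNIV. x i j) = n}"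
  by (rule bij_betwI[where g = case_prod])
     (auto simp: deg_def sum.cartesian_product UNIV_Times_UNIV curry_def split_def)

context
  fixes Lam :: "nat \<Rightarrow> 'n::{finite,linorder} sqmat"
  assumes Lam_nonneg: "\<And>m i j. Lam m $ i $ j \<ge> 0"
    and Lam_le_1: "\<And>m i j. Lam m $ i $ j \<le> 1"
    and Lam_0_pos: "\<And>i j. Lam 0 $ i $ j > 0"
begin

interpretation lagrange_system entry_list "Lam_hat_system Lam"
proof -
  interpret coordinate_list "entry_list :: ('n \<times> 'n) list"
    by (rule entry_list_enumerates)
  have expands: "expands (Lam_hat_coeff Lam i j) (Lam_hat_system Lam (i, j))" for i j
    unfolding Lam_hat_system_def using expands_lam_hat[of Lam i j, OF Lam_nonneg Lam_le_1] by simp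
  show "lagrange_system entry_list (Lam_hat_system Lam)"
  proof
    show "\<exists>c. expands c (Lam_hat_system Lam p)" for p
      using expands by (cases p) auto
    show "Lam_hat_system Lam p 0 > 0" for p
    proof (cases p)
      case (Pair i j)
      have "Lam_hat_system Lam (i, j) 0 = Lam 0 $ i $ j"
        unfolding expands_at_0[OF expands]
        by (simp add: Lam_hat_coeff_def deg_def if_distrib[of "(*) _"] cong: if_cong)
      then show ?thesis using Lam_0_pos by (simp add: Pair)
    qed
  qed
qed

lemma Q_mat_eq_lagrange_coeff:
  "Q_mat Lam n a $ i $ j = lagrange_coeff n (\<lambda>u. mpow (unflatten u) a $ i $ j)"
proof -
  let ?T = "\<lambda>x. 1 / (\<Prod>k\<in>UNIV. \<Prod>l\<in>UNIV. fact (x k l)) * B_mat Lam x a $ i $ j"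
  have "?T (curry \<alpha>) = taylor_coeff entry_list \<alpha>
      (\<lambda>u. mpow (unflatten u) a $ i $ j * lagrange_weight (Lam_hat_system Lam) \<alpha> u)" for \<alpha>
  proof -
    have fact: "(\<Prod>k\<in>UNIV. \<Prod>l\<in>UNIV. fact (curry \<alpha> k l)) = (\<Prod>p\<in>UNIV. fact (\<alpha> p) :: real)"
      by (simp add: prod.cartesian_product UNIV_Times_UNIV curry_def split_def)
    have weight: "(\<Prod>k\<in>UNIV. \<Prod>l\<in>UNIV. lam_hat Lam k l (unflatten u) ^ curry \<alpha> k l)
        * det (mat 1 - Gamma_mat Lam (unflatten u)) = lagrange_weight (Lam_hat_system Lam) \<alpha> u" for u
      by (simp add: lagrange_weight_def Gamma_mat_unflatten Lam_hat_system_def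
          prod.cartesian_product UNIV_Times_UNIV curry_def split_def)
    have zero: "(0 :: 'n sqmat) = unflatten 0"
      by (simp add: vec_eq_iff)
    have "B_mat Lam (curry \<alpha>) a $ i $ j
      = foldr (\<lambda>p. partial_deriv p ^^ \<alpha> p) entry_list
         (\<lambda>u. mpow (unflatten u) a $ i $ j * lagrange_weight (Lam_hat_system Lam) \<alpha> u) 0"
      unfolding B_mat_def zero vec_lambda_beta mixed_deriv_unflatten mult.assoc weight ..
    then show ?thesis
      unfolding taylor_coeff_def fact by simp
  qed
  then have "(\<Sum>\<alpha> | deg \<alpha> = n. ?T (curry \<alpha>)) = lagrange_coeff n (\<lambda>u. mpow (unflatten u) a $ i $ j)"
    by (simp add: lagrange_coeff_def)
  moreover have "(\<Sum>\<alpha> | deg \<alpha> = n. ?T (curry \<alpha>)) = Q_mat Lam n a $ i $ j"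
    unfolding sum.reindex_bij_betw[OF bij_betw_curry_deg, where g = ?T] by (simp add: Q_mat_def)
  ultimately show ?thesis
    by simp
qed

lemma Q_mat_0_left: "Q_mat Lam 0 a $ i $ j = (if a = 0 \<and> i = j then 1 else 0)"
proof -
  have "unflatten 0 = (0 :: 'n sqmat)"
    by (simp add: vec_eq_iff)
  then show ?thesis
    by (cases a) (simp_all add: Q_mat_eq_lagrange_coeff lagrange_coeff_0 mat_def matrix_matrix_mult_def)
qed

lemma Q_mat_Suc_0: "Q_mat Lam (Suc n) 0 $ i $ j = 0"
  using lagrange_coeff_cmult[OF expands_const[of 1], of "Suc n" "mat 1 $ i $ j"]
  by (simp add: Q_mat_eq_lagrange_coeff lagrange_coeff_const)

text \<open>Writing the matrix power as \<open>G\<^sup>a\<^sup>+\<^sup>1 = G G\<^sup>a\<close> and passing from \<open>n + 1\<close> to \<open>n\<close> replaces the left factor \<open>G\<close> by the matrix function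
  \<open>\<Sum>m. \<Lambda>(m) G\<^sup>m\<close>. Its terms with \<open>m \<le> n\<close> give the right hand side; the remainder \<open>R\<close> has no terms of degree
  at most \<open>n\<close> and is annihilated.\<close>

lemma Q_mat_Suc_Suc:
  "Q_mat Lam (Suc n) (Suc a) $ i $ j
   = (\<Sum>m\<le>n. \<Sum>l\<in>UNIV. Lam m $ i $ l * Q_mat Lam n (a + m) $ l $ j)"
proof -
  define f where "f b l u = mpow (unflatten u) b $ l $ j" for b l and u :: "real^('n \<times> 'n)"
  have f: "expands (walk_count b l j) (f b l)" for b l
    unfolding f_def by (rule expands_mpow)
  define R where "R l u = Lam_hat_system Lam (i, l) u
    - (\<Sum>m\<le>n. \<Sum>k\<in>UNIV. Lam m $ i $ k * mpow (unflatten u) m $ k $ l)" for l u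
  define \<rho> where "\<rho> l \<alpha> = Lam_hat_coeff Lam i l \<alpha>
    - (\<Sum>m\<le>n. \<Sum>k\<in>UNIV. Lam m $ i $ k * walk_count m k l \<alpha>)" for l \<alpha>
  have "expands (Lam_hat_coeff Lam i l) (Lam_hat_system Lam (i, l))" for l
    unfolding Lam_hat_system_def using expands_lam_hat[of Lam i l, OF Lam_nonneg Lam_le_1] by simp
  then have R: "expands (\<rho> l) (R l)" for l
    unfolding \<rho>_def R_def by (intro expands_diff expands_sum expands_cmult expands_mpow) auto
  have \<rho>: "\<rho> l \<alpha> = 0" if "deg \<alpha> \<le> n" for l \<alpha>
  proof -
    have "(\<Sum>m\<le>n. \<Sum>k\<in>UNIV. Lam m $ i $ k * walk_count m k l \<alpha>)
      = (\<Sum>m\<in>{deg \<alpha>}. \<Sum>k\<in>UNIV. Lam m $ i $ k * walk_count m k l \<alpha>)"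
      using that by (intro sum.mono_neutral_right) (auto simp: walk_count_eq_0 intro!: sum.neutral)
    then show ?thesis
      by (simp add: \<rho>_def Lam_hat_coeff_def)
  qed
  have first_step: "(\<Sum>l\<in>UNIV. Lam_hat_system Lam (i, l) u * f a l u)
    = (\<Sum>m\<le>n. \<Sum>k\<in>UNIV. Lam m $ i $ k * f (a + m) k u) + (\<Sum>l\<in>UNIV. R l u * f a l u)" for u
  proof -
    have "(\<Sum>l\<in>UNIV. (\<Sum>m\<le>n. \<Sum>k\<in>UNIV. Lam m $ i $ k * mpow (unflatten u) m $ k $ l) * f a l u)
      = (\<Sum>m\<le>n. \<Sum>k\<in>UNIV. Lam m $ i $ k * (\<Sum>l\<in>UNIV. mpow (unflatten u) m $ k $ l * f a l u))"
    proof -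
      have "(\<Sum>l\<in>UNIV. (\<Sum>m\<le>n. \<Sum>k\<in>UNIV. Lam m $ i $ k * mpow (unflatten u) m $ k $ l) * f a l u)
        = (\<Sum>l\<in>UNIV. \<Sum>m\<le>n. \<Sum>k\<in>UNIV. Lam m $ i $ k * (mpow (unflatten u) m $ k $ l * f a l u))"
        by (simp add: sum_distrib_right mult.assoc)
      also have "\<dots> = (\<Sum>m\<le>n. \<Sum>l\<in>UNIV. \<Sum>k\<in>UNIV. Lam m $ i $ k * (mpow (unflatten u) m $ k $ l * f a l u))"
        by (rule sum.swap)
      also have "\<dots> = (\<Sum>m\<le>n. \<Sum>k\<in>UNIV. \<Sum>l\<in>UNIV. Lam m $ i $ k * (mpow (unflatten u) m $ k $ l * f a l u))"
        by (intro sum.cong refl sum.swap)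
      finally show ?thesis
        by (simp add: sum_distrib_left)
    qed
    moreover have "(\<Sum>l\<in>UNIV. mpow (unflatten u) m $ k $ l * f a l u) = f (a + m) k u" for m k
      unfolding f_def add.commute[of a m] mpow_add by (simp add: matrix_matrix_mult_def)
    ultimately show ?thesis
      by (simp add: R_def left_diff_distrib sum_subtractf)
  qed
  have fm: "\<exists>c. expands c (\<lambda>u. \<Sum>k\<in>UNIV. Lam m $ i $ k * f (a + m) k u)" for m
    by (rule exI, rule expands_sum, rule expands_cmult, rule f)
  have "Q_mat Lam (Suc n) (Suc a) $ i $ j = lagrange_coeff (Suc n) (\<lambda>u. \<Sum>l\<in>UNIV. u $ (i, l) * f a l u)"
    by (simp add: Q_mat_eq_lagrange_coeff f_def matrix_matrix_mult_def)
  also have "\<dots> = (\<Sum>l\<in>UNIV. lagrange_coeff (Suc n) (\<lambda>u. u $ (i, l) * f a l u))"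
    by (rule lagrange_coeff_sum) (use expands_coord_mult[OF f] in blast)
  also have "\<dots> = (\<Sum>l\<in>UNIV. lagrange_coeff n (\<lambda>u. Lam_hat_system Lam (i, l) u * f a l u))"
    by (intro sum.cong refl lagrange_coeff_coord_mult[OF f])
  also have "\<dots> = lagrange_coeff n (\<lambda>u. \<Sum>l\<in>UNIV. Lam_hat_system Lam (i, l) u * f a l u)"
    by (rule lagrange_coeff_sum[symmetric]) (use g_expands expands_mult[OF _ f] in blast)
  also have "\<dots> = lagrange_coeff n (\<lambda>u. \<Sum>b\<in>{True, False}.
      if b then \<Sum>m\<le>n. \<Sum>k\<in>UNIV. Lam m $ i $ k * f (a + m) k u else \<Sum>l\<in>UNIV. R l u * f a l u)"
    by (simp add: first_step)
  also have "\<dots> = (\<Sum>b\<in>{True, False}. lagrange_coeff n (\<lambda>u.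
      if b then \<Sum>m\<le>n. \<Sum>k\<in>UNIV. Lam m $ i $ k * f (a + m) k u else \<Sum>l\<in>UNIV. R l u * f a l u))"
  proof (rule lagrange_coeff_sum)
    have "\<exists>c. expands c (\<lambda>u. \<Sum>m\<le>n. \<Sum>k\<in>UNIV. Lam m $ i $ k * f (a + m) k u)"
      by (rule exI, rule expands_sum, rule expands_sum, rule expands_cmult, rule f)
    moreover have "\<exists>c. expands c (\<lambda>u. \<Sum>l\<in>UNIV. R l u * f a l u)"
      by (rule exI, rule expands_sum, rule expands_mult[OF R f])
    ultimately show "\<exists>c. expands c (\<lambda>u. if b then \<Sum>m\<le>n. \<Sum>k\<in>UNIV. Lam m $ i $ k * f (a + m) k u
        else \<Sum>l\<in>UNIV. R l u * f a l u)" for b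
      by (cases b) simp_all
  qed
  also have "\<dots> = lagrange_coeff n (\<lambda>u. \<Sum>m\<le>n. \<Sum>k\<in>UNIV. Lam m $ i $ k * f (a + m) k u)
      + lagrange_coeff n (\<lambda>u. \<Sum>l\<in>UNIV. R l u * f a l u)"
    by simp
  also have "lagrange_coeff n (\<lambda>u. \<Sum>l\<in>UNIV. R l u * f a l u) = (\<Sum>l\<in>UNIV. lagrange_coeff n (\<lambda>u. R l u * f a l u))"
    by (rule lagrange_coeff_sum) (use expands_mult[OF R f] in blast)
  also have "\<dots> = 0"
    by (intro sum.neutral ballI lagrange_coeff_high_order[OF R \<rho> f])
  also have "lagrange_coeff n (\<lambda>u. \<Sum>m\<le>n. \<Sum>k\<in>UNIV. Lam m $ i $ k * f (a + m) k u)
      = (\<Sum>m\<le>n. lagrange_coeff n (\<lambda>u. \<Sum>k\<in>UNIV. Lam m $ i $ k * f (a + m) k u))"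
    by (rule lagrange_coeff_sum[OF fm])
  also have "\<dots> = (\<Sum>m\<le>n. \<Sum>k\<in>UNIV. lagrange_coeff n (\<lambda>u. Lam m $ i $ k * f (a + m) k u))"
    by (intro sum.cong refl lagrange_coeff_sum) (use expands_cmult[OF f] in blast)
  also have "\<dots> = (\<Sum>m\<le>n. \<Sum>k\<in>UNIV. Lam m $ i $ k * lagrange_coeff n (f (a + m) k))"
    by (intro sum.cong refl lagrange_coeff_cmult[OF f])
  finally show ?thesis
    by (simp add: Q_mat_eq_lagrange_coeff f_def[abs_def])
qed

end

section \<open>First passage of the surplus\<close>

text \<open>The number \<open>a\<close> is the distance still to climb: each step lowers it by one and raises it by the claim. The
  surplus cannot jump over a level, hence first passage happens exactly when the distance becomes \<open>0\<close>. The
  claims are \<open>c 1, c 2, \<dots>\<close>, as in the process.\<close>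

primrec first_passage :: "(nat \<Rightarrow> nat) \<Rightarrow> nat \<Rightarrow> nat \<Rightarrow> bool" where
  "first_passage c a 0 \<longleftrightarrow> a = 0"
| "first_passage c a (Suc n) \<longleftrightarrow> a > 0 \<and> first_passage (\<lambda>k. c (Suc k)) (a - 1 + c 1) n"

lemma first_passage_level_le: "first_passage c a n \<Longrightarrow> a \<le> n"
  by (induction n arbitrary: c a) (simp, fastforce)

lemma first_passage_iff:
  "first_passage c a n \<longleftrightarrow>
     int a \<le> int n - (\<Sum>k=1..n. int (c k)) \<and> (\<forall>t<n. int t - (\<Sum>k=1..t. int (c k)) < int a)"
proof (induction n arbitrary: c a)
  case (Suc n)
  have shift: "(\<Sum>k=1..Suc t. int (c k)) = int (c 1) + (\<Sum>k=1..t. int (c (Suc k)))" for t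
    by (simp only: One_nat_def sum.atLeast_Suc_atMost[of 1 "Suc t"] sum.shift_bounds_cl_Suc_ivl
        sum.atLeast_Suc_atMost le_add1 Suc_le_mono zero_le)
  have all_less: "(\<forall>t<Suc n. P t) \<longleftrightarrow> P 0 \<and> (\<forall>t<n. P (Suc t))" for P
    by (metis less_Suc_eq_0_disj)
  show ?case
  proof (cases a)
    case (Suc b)
    then show ?thesis
      unfolding all_less shift by (auto simp: Suc.IH algebra_simps)
  qed auto
qed simp

lemma Inf_enat_image_eq_iff:
  "Inf (enat ` S) = enat n \<longleftrightarrow> n \<in> S \<and> (\<forall>t<n. t \<notin> S)"
proof -
  have least: "Inf (enat ` S) = enat m" if "m \<in> S" "\<forall>t<m. t \<notin> S" for m
  proof (rule antisym)
    show "Inf (enat ` S) \<le> enat m"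
      using that by (intro Inf_lower) auto
    show "enat m \<le> Inf (enat ` S)"
      using that(2) by (intro Inf_greatest) (auto intro: leI)
  qed
  show ?thesis
  proof
    assume eq: "Inf (enat ` S) = enat n"
    then have "S \<noteq> {}"
      by (auto simp: top_enat_def)
    then obtain m where m: "m \<in> S" "\<forall>t<m. t \<notin> S"
      using exists_least_iff[of "\<lambda>m. m \<in> S"] by auto
    with least[OF m] eq show "n \<in> S \<and> (\<forall>t<n. t \<notin> S)"
      by simp
  qed (use least in blast)
qed

lemma upper_hitting_time_eq_iff:
  "upper_hitting_time C a \<omega> = enat n \<longleftrightarrow> first_passage (\<lambda>k. C k \<omega>) a n"
  unfolding upper_hitting_time_def Inf_enat_image_eq_iff first_passage_iff
  by (auto simp: surplus_def not_le)

section \<open>The first step of the process\<close>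

context compound_markov_binomial
begin

declare J_measurable [measurable] C_measurable [measurable]

lemma measurable_combine:
  fixes f :: "'w \<Rightarrow> 'x::countable" and h :: "'x \<Rightarrow> 'y \<Rightarrow> 'z"
  assumes f: "f \<in> measurable M (count_space UNIV)" and g: "g \<in> measurable M (count_space UNIV)"
  shows "(\<lambda>\<omega>. h (f \<omega>) (g \<omega>)) \<in> measurable M (count_space UNIV)"
proof (rule measurable_compose_countable[OF _ f])
  show "(\<lambda>\<omega>. h i (g \<omega>)) \<in> measurable M (count_space UNIV)" for i
    using g by (rule measurable_compose) simp
qed

lemma measurable_past [measurable]: "past C J n \<in> measurable M (count_space UNIV)"
proof -
  have map: "(\<lambda>\<omega>. map (\<lambda>l. f l \<omega>) ls) \<in> measurable M (count_space UNIV)"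
    if "\<And>l. l \<in> set ls \<Longrightarrow> f l \<in> measurable M (count_space UNIV)"
    for ls and f :: "nat \<Rightarrow> 'w \<Rightarrow> 'x::countable"
    using that
  proof (induction ls)
    case (Cons l ls)
    then have "(\<lambda>\<omega>. f l \<omega> # map (\<lambda>l. f l \<omega>) ls) \<in> measurable M (count_space UNIV)"
      by (intro measurable_combine[where h = "(#)"]) auto
    then show ?case by simp
  qed simp
  have C: "C l \<in> measurable M (count_space UNIV)" if l: "l \<in> set [1..<Suc n]" for l
  proof -
    have "l \<noteq> 0"
      using l by auto
    then show ?thesis
      using C_measurable[of "l - 1"] by simp
  qed
  show ?thesis
    unfolding past_def[abs_def]
    by (rule measurable_combine[where h = Pair, OF map[OF J_measurable] map[OF C]])
qed

lemma measurable_first_passage [measurable]: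
  "(\<lambda>\<omega>. first_passage (\<lambda>k. C (s + k) \<omega>) a n) \<in> measurable M (count_space UNIV)"
proof (induction n arbitrary: s a)
  case (Suc n)
  have "(\<lambda>\<omega>. first_passage (\<lambda>k. C (Suc s + k) \<omega>) (a - 1 + C (Suc s) \<omega>) n) \<in> measurable M (count_space UNIV)"
    by (rule measurable_compose_countable[OF Suc.IH C_measurable])
  then have "(\<lambda>\<omega>. 0 < a \<and> first_passage (\<lambda>k. C (Suc s + k) \<omega>) (a - 1 + C (Suc s) \<omega>) n)
      \<in> measurable M (count_space UNIV)"
    by (rule measurable_compose) simp
  then show ?case
    by (simp only: first_passage.simps add_Suc_right add_Suc One_nat_def add_0_right)
qed simp

text \<open>The kernel is prescribed only at states of positive probability. Some state has positive probability at
  time \<open>0\<close>, and since the entries of \<open>Lam 0\<close> are positive, every state has positive probability at time \<open>1\<close>.\<close>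

lemma Lam_eq_prob:
  "\<exists>n. \<forall>m j. Lam m $ i $ j = \<P>(\<omega> in M. C (Suc n) \<omega> = m \<and> J (Suc n) \<omega> = j \<bar> J n \<omega> = i)"
proof -
  have "\<exists>i0. \<P>(\<omega> in M. J 0 \<omega> = i0) > 0"
  proof (rule ccontr)
    assume "\<not> ?thesis"
    then have "\<P>(\<omega> in M. J 0 \<omega> = i0) = 0" for i0
      unfolding zero_less_measure_iff by blast
    moreover have "\<P>(\<omega> in M. \<exists>i0\<in>UNIV. J 0 \<omega> = i0) = (\<Sum>i0\<in>UNIV. \<P>(\<omega> in M. J 0 \<omega> = i0))"
      by (rule prob_sum) simp_all
    ultimately have "prob (space M) = 0"
      by simp
    then show False
      unfolding prob_space by simp
  qed
  then obtain i0 where i0: "\<P>(\<omega> in M. J 0 \<omega> = i0) > 0"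
    by blast
  have "0 < \<P>(\<omega> in M. C (Suc 0) \<omega> = 0 \<and> J (Suc 0) \<omega> = i \<bar> J 0 \<omega> = i0)"
    using kernel[OF i0] Lam0_pos by simp
  also have "\<dots> = \<P>(\<omega> in M. (C (Suc 0) \<omega> = 0 \<and> J (Suc 0) \<omega> = i) \<and> J 0 \<omega> = i0) / \<P>(\<omega> in M. J 0 \<omega> = i0)"
    by (simp add: cond_prob_def)
  finally have "0 < \<P>(\<omega> in M. (C (Suc 0) \<omega> = 0 \<and> J (Suc 0) \<omega> = i) \<and> J 0 \<omega> = i0)"
    using i0 by (simp add: zero_less_divide_iff)
  also have "\<dots> \<le> \<P>(\<omega> in M. J 1 \<omega> = i)"
    by (intro finite_measure_mono) auto
  finally have "\<P>(\<omega> in M. J 1 \<omega> = i) > 0" .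
  from kernel[OF this] show ?thesis
    by metis
qed

lemma Lam_nonneg: "Lam m $ i $ j \<ge> 0"
  using Lam_eq_prob[of i] by (auto simp: cond_prob_def)

lemma Lam_le_1: "Lam m $ i $ j \<le> 1"
proof -
  obtain n where "Lam m $ i $ j = \<P>(\<omega> in M. C (Suc n) \<omega> = m \<and> J (Suc n) \<omega> = j \<bar> J n \<omega> = i)"
    using Lam_eq_prob by blast
  also have "\<dots> \<le> 1"
    unfolding cond_prob_def by (auto intro!: divide_le_eq_1[THEN iffD2] finite_measure_mono simp: less_le)
  finally show ?thesis .
qed

text \<open>Given \<open>J s = i\<close>, this is the Markov additive property; if that event is null, both sides vanish.\<close>

lemma prob_step:
  "\<P>(\<omega> in M. (past C J s \<omega> \<in> A \<and> J s \<omega> = i) \<and> C (Suc s) \<omega> = m \<and> J (Suc s) \<omega> = j)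
   = \<P>(\<omega> in M. past C J s \<omega> \<in> A \<and> J s \<omega> = i) * Lam m $ i $ j"
proof (cases "\<P>(\<omega> in M. J s \<omega> = i) > 0")
  case True
  have "\<P>(\<omega> in M. ((C (Suc s) \<omega> = m \<and> J (Suc s) \<omega> = j) \<and> past C J s \<omega> \<in> A) \<and> J s \<omega> = i)
      / \<P>(\<omega> in M. J s \<omega> = i)
    = Lam m $ i $ j * (\<P>(\<omega> in M. past C J s \<omega> \<in> A \<and> J s \<omega> = i) / \<P>(\<omega> in M. J s \<omega> = i))"
    using markov_additive[of s m j A i] unfolding kernel[OF True] unfolding cond_prob_def .
  with True have "\<P>(\<omega> in M. ((C (Suc s) \<omega> = m \<and> J (Suc s) \<omega> = j) \<and> past C J s \<omega> \<in> A) \<and> J s \<omega> = i)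
    = Lam m $ i $ j * \<P>(\<omega> in M. past C J s \<omega> \<in> A \<and> J s \<omega> = i)"
    by (simp add: field_simps)
  moreover have "((past C J s \<omega> \<in> A \<and> J s \<omega> = i) \<and> C (Suc s) \<omega> = m \<and> J (Suc s) \<omega> = j) \<longleftrightarrow>
      ((C (Suc s) \<omega> = m \<and> J (Suc s) \<omega> = j) \<and> past C J s \<omega> \<in> A) \<and> J s \<omega> = i" for \<omega>
    by blast
  ultimately show ?thesis
    by (simp only: mult.commute)
next
  case False
  then have null: "\<P>(\<omega> in M. J s \<omega> = i) = 0"
    unfolding zero_less_measure_iff by blast
  have "\<P>(\<omega> in M. Q \<omega> \<and> J s \<omega> = i) = 0" for Q
  proof -
    have "\<P>(\<omega> in M. Q \<omega> \<and> J s \<omega> = i) \<le> \<P>(\<omega> in M. J s \<omega> = i)"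
      by (intro finite_measure_mono) auto
    then show ?thesis
      unfolding null measure_le_0_iff .
  qed
  from this[of "\<lambda>\<omega>. past C J s \<omega> \<in> A"]
    this[of "\<lambda>\<omega>. past C J s \<omega> \<in> A \<and> C (Suc s) \<omega> = m \<and> J (Suc s) \<omega> = j"]
  show ?thesis
    by (simp add: conj_ac)
qed

end

text \<open>The induction on \<open>n\<close> starts the process at an arbitrary time \<open>s\<close> with an arbitrary event of the past,
  because the first step turns the claim and the state at time \<open>s\<close> into part of the past of time \<open>s + 1\<close>.\<close>

lemma prob_first_passage:
  fixes M :: "'w measure"
    and J :: "nat \<Rightarrow> 'w \<Rightarrow> 'n::{finite,linorder}"
  assumes "compound_markov_binomial M J P C Lam"
  shows "\<P>(\<omega> in M. (past C J s \<omega> \<in> A \<and> J s \<omega> = i)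
      \<and> first_passage (\<lambda>k. C (s + k) \<omega>) a n \<and> J (s + n) \<omega> = j)
    = \<P>(\<omega> in M. past C J s \<omega> \<in> A \<and> J s \<omega> = i) * Q_mat Lam n a $ i $ j"
proof -
  interpret compound_markov_binomial M J P C Lam
    by fact
  note Q_0 = Q_mat_0_left[of Lam, OF Lam_nonneg Lam_le_1 Lam0_pos]
    and Q_Suc_0 = Q_mat_Suc_0[of Lam, OF Lam_nonneg Lam_le_1 Lam0_pos]
    and Q_Suc_Suc = Q_mat_Suc_Suc[of Lam, OF Lam_nonneg Lam_le_1 Lam0_pos]
  show ?thesis
  proof (induction n arbitrary: s A i a)
    case 0
    show ?case
    proof (cases "a = 0 \<and> i = j")
      case False
      then have "{\<omega> \<in> space M. (past C J s \<omega> \<in> A \<and> J s \<omega> = i)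
          \<and> first_passage (\<lambda>k. C (s + k) \<omega>) a 0 \<and> J (s + 0) \<omega> = j} = {}"
        by auto
      with False show ?thesis
        by (simp only: Q_0 measure_empty if_False mult_zero_right)
    qed (auto simp: Q_0 intro: arg_cong[where f = prob])
  next
    case (Suc n)
    show ?case
    proof (cases a)
      case 0
      then show ?thesis by (simp add: Q_Suc_0)
    next
      case (Suc b)
      let ?E = "\<lambda>\<omega>. past C J s \<omega> \<in> A \<and> J s \<omega> = i"
      let ?F = "\<lambda>m l \<omega>. (?E \<omega> \<and> C (Suc s) \<omega> = m \<and> J (Suc s) \<omega> = l)
        \<and> first_passage (\<lambda>k. C (Suc s + k) \<omega>) (b + m) n \<and> J (Suc s + n) \<omega> = j"
      have F: "\<P>(\<omega> in M. ?F m l \<omega>) = \<P>(\<omega> in M. ?E \<omega>) * (Lam m $ i $ l * Q_mat Lam n (b + m) $ l $ j)" for m l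
      proof -
        \<comment> \<open>The past at time \<open>s + 1\<close>, with its last entries split off, is the past at time \<open>s\<close>.\<close>
        define A' where "A' = {(js, cs). (butlast js, butlast cs) \<in> A \<and> last (butlast js) = i \<and> last cs = m}"
        have past_Suc: "past C J (Suc s) \<omega> \<in> A' \<longleftrightarrow> ?E \<omega> \<and> C (Suc s) \<omega> = m" for \<omega>
        proof -
          have "past C J (Suc s) \<omega> = (fst (past C J s \<omega>) @ [J (Suc s) \<omega>], snd (past C J s \<omega>) @ [C (Suc s) \<omega>])"
            by (simp add: past_def)
          moreover have "last (fst (past C J s \<omega>)) = J s \<omega>"
            by (simp add: past_def)
          ultimately show ?thesis
            by (simp add: A'_def)
        qed
        have "\<P>(\<omega> in M. ?F m l \<omega>) = \<P>(\<omega> in M. (past C J (Suc s) \<omega> \<in> A' \<and> J (Suc s) \<omega> = l)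
            \<and> first_passage (\<lambda>k. C (Suc s + k) \<omega>) (b + m) n \<and> J (Suc s + n) \<omega> = j)"
          unfolding past_Suc by (simp only: conj_assoc)
        also have "\<dots> = \<P>(\<omega> in M. past C J (Suc s) \<omega> \<in> A' \<and> J (Suc s) \<omega> = l) * Q_mat Lam n (b + m) $ l $ j"
          by (rule Suc.IH)
        also have "\<P>(\<omega> in M. past C J (Suc s) \<omega> \<in> A' \<and> J (Suc s) \<omega> = l) = \<P>(\<omega> in M. ?E \<omega>) * Lam m $ i $ l"
          unfolding past_Suc using prob_step[of s A i m l] by (simp only: conj_assoc)
        finally show ?thesis
          by (simp only: mult.assoc)
      qed
      \<comment> \<open>A remaining distance larger than \<open>n\<close> cannot be climbed in \<open>n\<close> steps, so the sum over claims is finite.\<close>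
      have claim_le: "C (Suc s) \<omega> \<le> n"
        if "first_passage (\<lambda>k. C (Suc (s + k)) \<omega>) (b + C (Suc s) \<omega>) n" for \<omega>
        using first_passage_level_le[OF that] by simp
      have "\<P>(\<omega> in M. ?E \<omega> \<and> first_passage (\<lambda>k. C (s + k) \<omega>) a (Suc n) \<and> J (s + Suc n) \<omega> = j)
        = (\<Sum>p\<in>{..n} \<times> UNIV. \<P>(\<omega> in M. ?F (fst p) (snd p) \<omega>))"
      proof (rule prob_sum)
        show "{\<omega> \<in> space M. ?F (fst p) (snd p) \<omega>} \<in> events" for p
          by measurable
        show "AE \<omega> in M. (\<forall>p\<in>{..n} \<times> UNIV. ?F (fst p) (snd p) \<omega> \<longrightarrow>
              ?E \<omega> \<and> first_passage (\<lambda>k. C (s + k) \<omega>) a (Suc n) \<and> J (s + Suc n) \<omega> = j)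
            \<and> (?E \<omega> \<and> first_passage (\<lambda>k. C (s + k) \<omega>) a (Suc n) \<and> J (s + Suc n) \<omega> = j \<longrightarrow>
              (\<exists>!p. p \<in> {..n} \<times> UNIV \<and> ?F (fst p) (snd p) \<omega>))"
          by (rule AE_I2) (auto simp: Suc dest: claim_le)
        show "{\<omega> \<in> space M. ?E \<omega> \<and> first_passage (\<lambda>k. C (s + k) \<omega>) a (Suc n) \<and> J (s + Suc n) \<omega> = j} \<in> events"
          by measurable
      qed simp
      also have "\<dots> = (\<Sum>m\<le>n. \<Sum>l\<in>UNIV. \<P>(\<omega> in M. ?E \<omega>) * (Lam m $ i $ l * Q_mat Lam n (b + m) $ l $ j))"
        unfolding F by (simp only: sum.cartesian_product split_def)
      finally show ?thesis
        by (simp add: Suc Q_Suc_Suc sum_distrib_left)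
    qed
  qed
qed

theorem theorem2:
  fixes M :: "'w measure"
    and J :: "nat \<Rightarrow> 'w \<Rightarrow> 'n::{finite,linorder}"
    and P :: "'n sqmat"
    and C :: "nat \<Rightarrow> 'w \<Rightarrow> nat"
    and Lam :: "nat \<Rightarrow> 'n sqmat"
    and a n :: nat
    and i j :: 'n
  assumes "compound_markov_binomial M J P C Lam"
    and "a \<le> n"
    and "\<P>(\<omega> in M. J 0 \<omega> = i) > 0"
  shows "\<P>(\<omega> in M. upper_hitting_time C a \<omega> = enat n
            \<and> J (the_enat (upper_hitting_time C a \<omega>)) \<omega> = j \<bar> J 0 \<omega> = i)
         = Q_mat Lam n a $ i $ j"
proof -
  have "(upper_hitting_time C a \<omega> = enat n \<and> J (the_enat (upper_hitting_time C a \<omega>)) \<omega> = j) \<and> J 0 \<omega> = i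
    \<longleftrightarrow> (past C J 0 \<omega> \<in> UNIV \<and> J 0 \<omega> = i) \<and> first_passage (\<lambda>k. C (0 + k) \<omega>) a n \<and> J (0 + n) \<omega> = j" for \<omega>
    by (auto simp flip: upper_hitting_time_eq_iff)
  then have "\<P>(\<omega> in M. (upper_hitting_time C a \<omega> = enat n
      \<and> J (the_enat (upper_hitting_time C a \<omega>)) \<omega> = j) \<and> J 0 \<omega> = i)
    = \<P>(\<omega> in M. J 0 \<omega> = i) * Q_mat Lam n a $ i $ j"
    using prob_first_passage[OF assms(1), of 0 UNIV i a n j] by simp
  with assms(3) show ?thesis
    by (simp add: cond_prob_def)
qed

end
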